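(* Let $R$ be a commutative ring with unity such that $\sigma(R)$ is finite, and let $J(R)$ be its Jacobson radical. Then either $\sigma(R) = \sigma(R/J(R))$, or $\sigma(R) = p^d + 1$ for some prime $p$ and some positive integer $d$.
   Context: All rings are associative and unital. A subring of a ring $R$ is a subset that is a group under addition and is closed under multiplication; it need not contain a multiplicative identity. A cover of $R$ is a collection of proper subrings of $R$ whose set-theoretic union equals $R$. If a cover exists, $R$ is coverable and $\sigma(R)$ denotes the cardinality of a minimal cover (a cover of least cardinality); if $R$ is not coverable, $\sigma(R) = \infty$. *)

theory Defs
  imports
    "HOL-Algebra.Algebra"
    "HOL-Computational_Algebra.Primes"
    "HOL-Library.Extended_Nat"
begin

text \<open>
  Subrings in the sense of covering problems need not contain the multiplicative identity, so
  the unital notion \<open>subring\<close> of HOL-Algebra is too restrictive.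
\<close>

definition nonunital_subring :: "'a set \<Rightarrow> ('a, 'm) ring_scheme \<Rightarrow> bool" where
  "nonunital_subring S R \<longleftrightarrow>
     additive_subgroup S R \<and> (\<forall>x\<in>S. \<forall>y\<in>S. x \<otimes>\<^bsub>R\<^esub> y \<in> S)"

definition ring_cover :: "('a, 'm) ring_scheme \<Rightarrow> 'a set set \<Rightarrow> bool" where
  "ring_cover R C \<longleftrightarrow>
     (\<forall>S\<in>C. nonunital_subring S R \<and> S \<noteq> carrier R) \<and> \<Union>C = carrier R"

text \<open>
  The covering number \<open>\<sigma>(R)\<close>. The infimum over the empty set is \<open>\<infinity>\<close>, so
  rings without a cover get the value \<open>\<infinity>\<close>; infinite cardinalities of covers are
  identified with \<open>\<infinity>\<close> as well. Hence \<open>covering_number R \<noteq> \<infinity>\<close> says exactly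
  that \<open>R\<close> has a finite cover, and then the infimum is the least cardinality of a cover.
\<close>

definition covering_number :: "('a, 'm) ring_scheme \<Rightarrow> enat" where
  "covering_number R =
     (INF C\<in>{C. ring_cover R C}. if finite C then enat (card C) else \<infinity>)"

text \<open>
  The Jacobson radical of a commutative ring. In a commutative ring left, right and two-sided
  ideals coincide; for noncommutative rings this would not be the Jacobson radical, since
  \<open>maximalideal\<close> is two-sided. Intersecting with the carrier only matters for the zero
  ring, which has no maximal ideals.
\<close>

definition jacobson_radical :: "('a, 'm) ring_scheme \<Rightarrow> 'a set" where
  "jacobson_radical R = carrier R \<inter> \<Inter>{M. maximalideal M R}"

end

theory Submission
  imports Defs
begin

text \<open>
  By B. H. Neumann's lemma the members of a minimal cover have finite index, so \<open>R\<close> may be replaced by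
  a finite quotient; let \<open>J\<close> be its Jacobson radical. If all members of a minimal cover by maximal
  subrings contain \<open>J\<close>, the cover descends to \<open>R / J\<close>. Otherwise some member \<open>M\<close> does not contain \<open>J\<close>.
  Then \<open>M + J = R\<close>, and \<open>N = M \<inter> J\<close> is an ideal containing \<open>J\<^sup>2\<close> such that \<open>J / N\<close> is a simple module,
  with annihilator \<open>m\<close> and residue field of order \<open>q\<close>, say; moreover \<open>M\<close> is determined by \<open>N\<close>.
  Counting the points of a suitable coset of a submodule of \<open>J\<close> shows that the cover has at least \<open>q + 1\<close>
  members, among them a second one \<open>M'\<close> with the same \<open>m\<close>. But then \<open>J / (M \<inter> M' \<inter> J)\<close> is a plane over
  \<open>R / m\<close>, and the subrings \<open>(M \<inter> M') + L\<close> for its \<open>q + 1\<close> lines \<open>L\<close> already cover \<open>R\<close>.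
\<close>

section \<open>Covers and finite index\<close>

text \<open>Members of a cover need not contain \<open>\<one>\<close>, so
  \<open>M \<inter> J\<close> is not visibly stable under \<open>R\<close>. Stability follows from
  \<open>M + J = R\<close> once \<open>J * J\<close> lies in \<open>M\<close>, and that inclusion
  comes from a Nakayama argument on a minimal principal ideal. That \<open>N\<close> determines
  \<open>M\<close> is a Frobenius phenomenon: for \<open>d\<close> in \<open>J\<close>,
  \<open>(a + d)^q\<close> and \<open>a^q\<close> agree modulo \<open>N\<close>, so an element fixed
  by the \<open>q\<close>-th power modulo \<open>J\<close> has only one lift modulo
  \<open>N\<close>. One such element outside \<open>m\<close> is enough: an \<open>e\<close> lying
  in every maximal ideal except \<open>m\<close>. The same \<open>e\<close> selects the coset to
  count in. The submodule \<open>eJ\<close> lies in every maximal subring that contains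
  \<open>J\<close> or has a conductor other than \<open>m\<close>, while \<open>e\<close> acts
  invertibly on \<open>J / N\<close> when the conductor is \<open>m\<close>. Disjoint pieces would
  only give the bound \<open>q\<close>; an overlap of two pieces gives \<open>q + 1\<close>, which
  is also the number of points of the projective line over \<open>R / m\<close>. The radical of the
  finite quotient may exceed the image of \<open>J(R)\<close>. This is harmless, because preimages
  of sets containing it still contain \<open>J(R)\<close>.\<close>

lemma covering_number_le_card:
  assumes "ring_cover R C" "finite C"
  shows "covering_number R \<le> enat (card C)"
  unfolding covering_number_def using assms by (intro INF_lower2[of C]) auto

text \<open>\<open>enat\<close> is well-ordered, so the infimum of a nonempty set is attained; a
  finite value can only come from a finite cover.\<close>

lemma covering_number_attained:
  assumes "covering_number R \<noteq> \<infinity>"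
  obtains C where "ring_cover R C" "finite C" "covering_number R = enat (card C)"
proof -
  let ?f = "\<lambda>C :: 'a set set. if finite C then enat (card C) else \<infinity>"
  have ne: "{C. ring_cover R C} \<noteq> {}"
  proof
    assume e: "{C. ring_cover R C} = {}"
    have "covering_number R = \<infinity>"
      unfolding covering_number_def e by (simp add: top_enat_def)
    with assms show False ..
  qed
  then have "Inf (?f ` {C. ring_cover R C}) \<in> ?f ` {C. ring_cover R C}"
    by (metis (no_types, lifting) ex_in_conv imageI wellorder_InfI)
  then obtain C where "ring_cover R C" "covering_number R = ?f C"
    by (auto simp: covering_number_def)
  with assms that show ?thesis by (auto split: if_splits)
qed

lemma (in abelian_group) additive_subgroup_diff:
  assumes "additive_subgroup S G" "x \<in> S" "y \<in> S"
  shows "x \<ominus> y \<in> S"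
proof -
  interpret additive_subgroup S G by fact
  show ?thesis
    using assms abelian_group_axioms by (simp add: a_minus_def)
qed

section \<open>Arithmetic of nonunital subrings\<close>

context ring
begin

lemma nonunital_subringI:
  assumes "S \<subseteq> carrier R" "\<zero> \<in> S"
    and "\<And>x y. x \<in> S \<Longrightarrow> y \<in> S \<Longrightarrow> x \<oplus> y \<in> S"
    and "\<And>x. x \<in> S \<Longrightarrow> \<ominus> x \<in> S"
    and "\<And>x y. x \<in> S \<Longrightarrow> y \<in> S \<Longrightarrow> x \<otimes> y \<in> S"
  shows "nonunital_subring S R"
  unfolding nonunital_subring_def
proof (intro conjI ballI)
  show "additive_subgroup S R"
  proof (rule additive_subgroupI)
    show "subgroup S (add_monoid R)"
      using assms by unfold_locales (auto simp: a_inv_def)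
  qed
qed (use assms in auto)

lemma nonunital_subringD:
  assumes "nonunital_subring S R"
  shows "additive_subgroup S R" "S \<subseteq> carrier R" "\<zero> \<in> S"
    and "x \<in> S \<Longrightarrow> y \<in> S \<Longrightarrow> x \<oplus> y \<in> S"
    and "x \<in> S \<Longrightarrow> \<ominus> x \<in> S"
    and "x \<in> S \<Longrightarrow> y \<in> S \<Longrightarrow> x \<ominus> y \<in> S"
    and "x \<in> S \<Longrightarrow> y \<in> S \<Longrightarrow> x \<otimes> y \<in> S"
proof -
  show *: "additive_subgroup S R"
    using assms by (simp add: nonunital_subring_def)
  interpret additive_subgroup S R by fact
  show "S \<subseteq> carrier R" "\<zero> \<in> S"
    by (simp_all add: a_subset)
  show "x \<in> S \<Longrightarrow> y \<in> S \<Longrightarrow> x \<oplus> y \<in> S" "x \<in> S \<Longrightarrow> \<ominus> x \<in> S"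
    using abelian_group_axioms by simp_all
  show "x \<in> S \<Longrightarrow> y \<in> S \<Longrightarrow> x \<ominus> y \<in> S"
    using additive_subgroup_diff[OF *] .
  show "x \<in> S \<Longrightarrow> y \<in> S \<Longrightarrow> x \<otimes> y \<in> S"
    using assms by (simp add: nonunital_subring_def)
qed

lemma ideal_nonunital_subring:
  assumes "ideal I R"
  shows "nonunital_subring I R"
proof -
  interpret ideal I R by fact
  show ?thesis
    unfolding nonunital_subring_def
    using is_additive_subgroup I_l_closed a_subset by blast
qed

lemma nonunital_subring_Inter:
  assumes "\<And>S. S \<in> C \<Longrightarrow> nonunital_subring S R"
  shows "nonunital_subring (carrier R \<inter> \<Inter>C) R"
  using nonunital_subringD[OF assms] by (intro nonunital_subringI) auto

lemma nonunital_subring_add_ideal: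
  assumes M: "nonunital_subring M R" and I: "ideal I R"
  shows "nonunital_subring (M <+>\<^bsub>R\<^esub> I) R" "M \<subseteq> M <+>\<^bsub>R\<^esub> I" "I \<subseteq> M <+>\<^bsub>R\<^esub> I"
proof -
  interpret ideal I R by fact
  note [simp] = nonunital_subringD(3-7)[OF M] I_l_closed I_r_closed
  have car [simp]: "x \<in> carrier R" if "x \<in> M" for x
    using that nonunital_subringD(2)[OF M] by blast
  note [simp] = a_Hcarr
  have mem: "z \<in> M <+>\<^bsub>R\<^esub> I \<longleftrightarrow> (\<exists>m\<in>M. \<exists>i\<in>I. z = m \<oplus> i)" for z
    by (auto simp: set_add_def')
  have memI: "m \<oplus> i \<in> M <+>\<^bsub>R\<^esub> I" if "m \<in> M" "i \<in> I" for m i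
    using that mem by blast
  show "nonunital_subring (M <+>\<^bsub>R\<^esub> I) R"
  proof (rule nonunital_subringI)
    show "M <+>\<^bsub>R\<^esub> I \<subseteq> carrier R" by (auto simp: mem)
    show "\<zero> \<in> M <+>\<^bsub>R\<^esub> I" using memI[of \<zero> \<zero>] by simp
  next
    fix x y assume "x \<in> M <+>\<^bsub>R\<^esub> I" "y \<in> M <+>\<^bsub>R\<^esub> I"
    then obtain m i m' i' where *: "m \<in> M" "i \<in> I" "m' \<in> M" "i' \<in> I"
      "x = m \<oplus> i" "y = m' \<oplus> i'" by (auto simp: mem)
    have "x \<oplus> y = (m \<oplus> m') \<oplus> (i \<oplus> i')"
      using * by (simp add: a_ac)
    then show "x \<oplus> y \<in> M <+>\<^bsub>R\<^esub> I"
      using * memI by simp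
    have "x \<otimes> y = m \<otimes> m' \<oplus> (m \<otimes> i' \<oplus> (i \<otimes> m' \<oplus> i \<otimes> i'))"
      using * by (simp add: l_distr r_distr a_ac)
    then show "x \<otimes> y \<in> M <+>\<^bsub>R\<^esub> I"
      using * memI by simp
  next
    fix x assume "x \<in> M <+>\<^bsub>R\<^esub> I"
    then obtain m i where *: "m \<in> M" "i \<in> I" "x = m \<oplus> i" by (auto simp: mem)
    then have "\<ominus> x = \<ominus> m \<oplus> \<ominus> i"
      by (simp add: minus_add)
    then show "\<ominus> x \<in> M <+>\<^bsub>R\<^esub> I"
      using * memI by simp
  qed
  show "M \<subseteq> M <+>\<^bsub>R\<^esub> I"
  proof
    fix m assume "m \<in> M"
    then show "m \<in> M <+>\<^bsub>R\<^esub> I" using memI[of m \<zero>] by simp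
  qed
  show "I \<subseteq> M <+>\<^bsub>R\<^esub> I"
  proof
    fix i assume "i \<in> I"
    then show "i \<in> M <+>\<^bsub>R\<^esub> I" using memI[of \<zero> i] by simp
  qed
qed

end

section \<open>Transfer of covers along surjective homomorphisms\<close>

context ring_hom_ring
begin

lemma nonunital_subring_vimage:
  assumes "nonunital_subring U S"
  shows "nonunital_subring {x \<in> carrier R. h x \<in> U} R"
  using S.nonunital_subringD[OF assms]
  by (intro R.nonunital_subringI) (auto simp: hom_a_inv)

lemma nonunital_subring_image:
  assumes "nonunital_subring U R"
  shows "nonunital_subring (h ` U) S"
proof -
  note U = R.nonunital_subringD[OF assms]
  have car: "x \<in> carrier R" if "x \<in> U" for x using U(2) that by blast
  show ?thesis
  proof (rule S.nonunital_subringI)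
    show "h ` U \<subseteq> carrier S" using car by auto
    show "\<zero>\<^bsub>S\<^esub> \<in> h ` U" using U(3) hom_zero by (metis imageI)
  next
    fix x y assume "x \<in> h ` U" "y \<in> h ` U"
    then show "x \<oplus>\<^bsub>S\<^esub> y \<in> h ` U" "x \<otimes>\<^bsub>S\<^esub> y \<in> h ` U"
      using U car by (auto simp flip: hom_add hom_mult)
  next
    fix x assume "x \<in> h ` U"
    then show "\<ominus>\<^bsub>S\<^esub> x \<in> h ` U"
      using U car by (auto simp flip: hom_a_inv)
  qed
qed

lemma ring_cover_vimage:
  assumes surj: "h ` carrier R = carrier S" and C: "ring_cover S C"
  shows "ring_cover R ((\<lambda>U. {x \<in> carrier R. h x \<in> U}) ` C)"
  unfolding ring_cover_def
proof (intro conjI ballI)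
  fix Y assume "Y \<in> (\<lambda>U. {x \<in> carrier R. h x \<in> U}) ` C"
  then obtain U where U: "U \<in> C" "Y = {x \<in> carrier R. h x \<in> U}" by auto
  with C have sub: "nonunital_subring U S" "U \<noteq> carrier S"
    by (auto simp: ring_cover_def)
  then show "nonunital_subring Y R"
    using U nonunital_subring_vimage by simp
  have "U \<subseteq> carrier S"
    using sub S.nonunital_subringD(2) by blast
  with sub obtain s where "s \<in> carrier S" "s \<notin> U" by blast
  then obtain r where "r \<in> carrier R" "h r \<notin> U" using surj by (metis imageE)
  then show "Y \<noteq> carrier R" using U by auto
next
  have "\<exists>U\<in>C. h x \<in> U" if "x \<in> carrier R" for x
    using that C hom_closed by (auto simp: ring_cover_def)
  then show "\<Union>((\<lambda>U. {x \<in> carrier R. h x \<in> U}) ` C) = carrier R" by auto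
qed

lemma covering_number_le_image:
  assumes "h ` carrier R = carrier S"
  shows "covering_number R \<le> covering_number S"
proof (cases "covering_number S = \<infinity>")
  case False
  then obtain C where C: "ring_cover S C" "finite C" "covering_number S = enat (card C)"
    by (rule covering_number_attained)
  have "covering_number R \<le> enat (card ((\<lambda>U. {x \<in> carrier R. h x \<in> U}) ` C))"
    using covering_number_le_card[OF ring_cover_vimage[OF assms C(1)]] C(2) by simp
  also have "\<dots> \<le> covering_number S"
    using C card_image_le by simp
  finally show ?thesis .
qed simp

text \<open>The kernel hypothesis keeps images proper: if \<open>h r = h x\<close> with
  \<open>x\<close> in \<open>U\<close>, then \<open>r - x\<close> lies in the kernel, hence in
  \<open>U\<close>, and \<open>r\<close> would lie in \<open>U\<close> too.\<close>

lemma ring_cover_image: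
  assumes surj: "h ` carrier R = carrier S" and C: "ring_cover R C"
    and ker: "\<And>U. U \<in> C \<Longrightarrow> a_kernel R S h \<subseteq> U"
  shows "ring_cover S ((`) h ` C)"
  unfolding ring_cover_def
proof (intro conjI ballI)
  fix Y assume "Y \<in> (`) h ` C"
  then obtain U where U: "U \<in> C" "Y = h ` U" by auto
  with C have sub: "nonunital_subring U R" "U \<noteq> carrier R"
    by (auto simp: ring_cover_def)
  note D = R.nonunital_subringD[OF sub(1)]
  then show "nonunital_subring Y S"
    using U sub nonunital_subring_image by simp
  obtain r where r: "r \<in> carrier R" "r \<notin> U" using sub D(2) by blast
  have "h r \<notin> Y"
  proof
    assume "h r \<in> Y"
    then obtain x where x: "x \<in> U" "h r = h x" using U by auto
    then have xc: "x \<in> carrier R" using D(2) by blast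
    have "h (r \<ominus>\<^bsub>R\<^esub> x) = \<zero>\<^bsub>S\<^esub>"
    proof -
      have "h (r \<ominus>\<^bsub>R\<^esub> x) = h r \<oplus>\<^bsub>S\<^esub> \<ominus>\<^bsub>S\<^esub> h x"
        using r(1) xc by (simp add: a_minus_def)
      then show ?thesis
        using xc S.r_neg[of "h x"] by (simp add: x(2))
    qed
    then have "r \<ominus>\<^bsub>R\<^esub> x \<in> a_kernel R S h"
      unfolding a_kernel_def' using R.minus_closed[OF r(1) xc] by blast
    then have "r \<ominus>\<^bsub>R\<^esub> x \<in> U"
      using ker[OF U(1)] by blast
    then have "r \<ominus>\<^bsub>R\<^esub> x \<oplus>\<^bsub>R\<^esub> x \<in> U" using D(4) x by blast
    moreover have "r \<ominus>\<^bsub>R\<^esub> x \<oplus>\<^bsub>R\<^esub> x = r"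
      using r xc by (simp add: a_minus_def R.a_assoc R.l_neg)
    ultimately show False using r by simp
  qed
  then show "Y \<noteq> carrier S" using r by auto
next
  show "\<Union>((`) h ` C) = carrier S"
    using C unfolding ring_cover_def by (simp add: surj flip: image_Union)
qed

end

lemma (in ideal) covering_number_Quot_le:
  assumes "ring_cover R C" "finite C" "\<And>U. U \<in> C \<Longrightarrow> I \<subseteq> U"
  shows "covering_number (R Quot I) \<le> enat (card C)"
proof -
  have surj: "(+>) I ` carrier R = carrier (R Quot I)"
    by (simp add: FactRing_simps UNION_singleton_eq_range)
  have ker: "a_kernel R (R Quot I) ((+>) I) \<subseteq> I"
  proof
    fix x assume "x \<in> a_kernel R (R Quot I) ((+>) I)"
    then have "x \<in> carrier R" "I +> x = I"
      by (simp_all add: a_kernel_def' FactRing_def)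
    then show "x \<in> I"
      by (rule rcos_const_imp_mem)
  qed
  interpret h: ring_hom_ring R "R Quot I" "(+>) I"
    by (rule rcos_ring_hom_ring)
  have "covering_number (R Quot I) \<le> enat (card ((`) ((+>) I) ` C))"
    using assms ker by (intro covering_number_le_card h.ring_cover_image[OF surj]) auto
  also have "\<dots> \<le> enat (card C)"
    using card_image_le[OF assms(2)] by simp
  finally show ?thesis .
qed

text \<open>B. H. Neumann: downward induction on \<open>S \<subseteq> C\<close>, translating \<open>\<Inter>S\<close> by an element missed by \<open>\<Union>S\<close>.\<close>

lemma (in ring) irredundant_cover_finite_index:
  assumes fin: "finite C" and sub: "\<And>H. H \<in> C \<Longrightarrow> additive_subgroup H R"
    and cov: "\<Union>C = carrier R" and irr: "\<And>S. S \<subset> C \<Longrightarrow> \<Union>S \<noteq> carrier R"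
  obtains T where "finite T" "T \<subseteq> carrier R"
    "\<And>x. x \<in> carrier R \<Longrightarrow> \<exists>t\<in>T. x \<ominus> t \<in> carrier R \<inter> \<Inter>C"
proof -
  have diff: "x \<ominus> y \<in> H" if "H \<in> C" "x \<in> H" "y \<in> H" for x y H
    using additive_subgroup_diff[OF sub[OF that(1)] that(2,3)] .
  \<comment> \<open>\<open>T\<close> meets every coset of \<open>\<Inter>C\<close> in
    \<open>\<Inter>S\<close>. The carrier is intersected in because \<open>\<Inter>{}\<close> is the
    whole type; the case \<open>S = {}\<close> is the goal.\<close>
  define Q where "Q S T \<longleftrightarrow> finite T \<and> T \<subseteq> carrier R \<and>
      (\<forall>x\<in>carrier R \<inter> \<Inter>S. \<exists>t\<in>T. x \<ominus> t \<in> carrier R \<inter> \<Inter>C)" for S T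
  have step: "\<exists>T. Q S T" if "S \<subseteq> C" for S
    using that
  proof (induction "card (C - S)" arbitrary: S rule: less_induct)
    case less
    show ?case
    proof (cases "S = C")
      case True
      have "x \<ominus> \<zero> = x" if "x \<in> carrier R" for x
        using that by (simp add: a_minus_def)
      then have "Q C {\<zero>}"
        by (simp add: Q_def)
      with True show ?thesis by blast
    next
      case False
      with less.prems have "S \<subset> C" by blast
      then obtain y where y: "y \<in> carrier R" "y \<notin> \<Union>S"
        using irr[of S] cov by blast
      have "\<exists>T. Q (insert H S) T" if H: "H \<in> C - S" for H
      proof (rule less.hyps)
        have "C - insert H S \<subset> C - S" using H by blast
        then show "card (C - insert H S) < card (C - S)"
          using fin by (intro psubset_card_mono) auto
        show "insert H S \<subseteq> C" using H less.prems by blast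
      qed
      then obtain T where T: "\<And>H. H \<in> C - S \<Longrightarrow> Q (insert H S) (T H)"
        by metis
      \<comment> \<open>For \<open>x\<close> in \<open>\<Inter>S\<close>,
        \<open>y \<oplus> x\<close> avoids the members of \<open>S\<close>, since these would then
        contain \<open>y\<close>; so it lies in some \<open>H\<close> of \<open>C - S\<close>. For
        fixed \<open>H\<close> such \<open>x\<close> fill at most one coset of
        \<open>\<Inter>(insert H S)\<close>, represented by \<open>c H\<close>, and
        \<open>T H\<close> from the induction hypothesis, translated by \<open>c H\<close>, handles
        that coset.\<close>
      define P where "P H x \<longleftrightarrow> x \<in> carrier R \<inter> \<Inter>S \<and> y \<oplus> x \<in> H" for H x
      define c where "c H = (SOME x. P H x)" for H
      define U where "U = (\<Union>H\<in>{H\<in>C - S. \<exists>x. P H x}. (\<lambda>t. c H \<oplus> t) ` T H)"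
      have c: "P H (c H)" if "P H x" for H x
        unfolding c_def using that by (rule someI)
      have "finite U"
        unfolding U_def using fin T by (auto simp: Q_def)
      moreover have "U \<subseteq> carrier R"
      proof
        fix u assume "u \<in> U"
        then obtain H x t where H: "H \<in> C - S" "P H x" "t \<in> T H" "u = c H \<oplus> t"
          unfolding U_def by blast
        then have "c H \<in> carrier R" "t \<in> carrier R"
          using c[OF H(2)] T[OF H(1)] by (auto simp: P_def Q_def)
        with H show "u \<in> carrier R" by simp
      qed
      moreover have "\<exists>u\<in>U. x \<ominus> u \<in> carrier R \<inter> \<Inter>C" if x: "x \<in> carrier R \<inter> \<Inter>S" for x
      proof -
        have xc: "x \<in> carrier R" using x by blast
        have "y \<oplus> x \<in> \<Union>C" using xc y cov by simp
        then obtain H where H: "H \<in> C" "y \<oplus> x \<in> H" by blast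
        have "H \<notin> S"
        proof
          assume "H \<in> S"
          then have "(y \<oplus> x) \<ominus> x \<in> H" using x H diff by blast
          moreover have "(y \<oplus> x) \<ominus> x = y"
            using xc y(1) by algebra
          ultimately show False using y \<open>H \<in> S\<close> by auto
        qed
        have Px: "P H x" using x H by (simp add: P_def)
        note Pc = c[OF Px]
        have cc: "c H \<in> carrier R" "x \<in> carrier R" using Pc x by (auto simp: P_def)
        have "(y \<oplus> x) \<ominus> (y \<oplus> c H) \<in> H"
          using Pc H by (intro diff) (auto simp: P_def)
        also have "(y \<oplus> x) \<ominus> (y \<oplus> c H) = x \<ominus> c H"
          using cc y(1) by algebra
        finally have "x \<ominus> c H \<in> H" .
        moreover have "x \<ominus> c H \<in> K" if "K \<in> S" for K
          using that x Pc less.prems by (intro diff) (auto simp: P_def)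
        ultimately have "x \<ominus> c H \<in> carrier R \<inter> \<Inter>(insert H S)"
          using cc by auto
        moreover have TH: "Q (insert H S) (T H)" using T H \<open>H \<notin> S\<close> by blast
        ultimately obtain t where t: "t \<in> T H" "x \<ominus> c H \<ominus> t \<in> carrier R \<inter> \<Inter>C"
          unfolding Q_def by blast
        have "t \<in> carrier R" using t TH by (auto simp: Q_def)
        then have "x \<ominus> (c H \<oplus> t) = x \<ominus> c H \<ominus> t"
          using cc by algebra
        moreover have "c H \<oplus> t \<in> U"
          unfolding U_def using t H \<open>H \<notin> S\<close> Px by blast
        ultimately show ?thesis using t by metis
      qed
      ultimately have "Q S U" by (simp add: Q_def)
      then show ?thesis by blast
    qed
  qed
  from step[of "{}"] obtain T where "Q {} T" by blast
  then have "finite T" "T \<subseteq> carrier R"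
      "\<And>x. x \<in> carrier R \<Longrightarrow> \<exists>t\<in>T. x \<ominus> t \<in> carrier R \<inter> \<Inter>C"
    unfolding Q_def by simp_all
  then show ?thesis by (rule that)
qed

text \<open>The witness is the largest ideal inside \<open>D\<close>, the elements all of whose
  multiples lie in \<open>D\<close>. Its index is finite because membership of \<open>x - y\<close>
  needs testing only against \<open>\<one>\<close> and \<open>T\<close>: in
  \<open>(x - y) s = (x - y) t + (x - y) (s - t)\<close> the last product lies in \<open>D\<close>
  by closure.\<close>

lemma (in cring) finite_index_subring_contains_ideal:
  assumes D: "nonunital_subring D R" and T: "finite T" "T \<subseteq> carrier R"
    and cov: "\<And>x. x \<in> carrier R \<Longrightarrow> \<exists>t\<in>T. x \<ominus> t \<in> D"
  obtains I where "ideal I R" "I \<subseteq> D" "finite (carrier (R Quot I))"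
proof -
  note DD = nonunital_subringD[OF D]
  define I where "I = {r \<in> carrier R. \<forall>s\<in>carrier R. r \<otimes> s \<in> D}"
  have ideal: "ideal I R"
  proof (rule idealI)
    show "subgroup I (add_monoid R)"
      using DD(3,4,5) by unfold_locales (auto simp: I_def l_distr l_minus simp flip: a_inv_def)
  qed (use ring_axioms in \<open>auto simp: I_def m_ac\<close>)
  interpret ideal I R by fact
  have sub: "I \<subseteq> D"
  proof
    fix x assume "x \<in> I"
    then have "x \<in> carrier R" "x \<otimes> \<one> \<in> D" unfolding I_def by blast+
    then show "x \<in> D" by simp
  qed
  define c where "c x = (SOME t. t \<in> T \<and> x \<ominus> t \<in> D)" for x
  have c: "c x \<in> T" "x \<ominus> c x \<in> D" if "x \<in> carrier R" for x
    using someI_ex[of "\<lambda>t. t \<in> T \<and> x \<ominus> t \<in> D"] cov[OF that] by (auto simp: c_def)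
  \<comment> \<open>Records the \<open>D\<close>-cosets of all \<open>x \<otimes> s\<close>. The
    index \<open>\<one>\<close> supplies \<open>x - y\<close> in \<open>D\<close> itself, which the
    closure argument needs; restriction to \<open>insert \<one> T\<close> leaves only finitely many
    such functions.\<close>
  define f where "f x = (\<lambda>s\<in>insert \<one> T. c (x \<otimes> s))" for x
  have same: "I +> x = I +> y" if xy: "x \<in> carrier R" "y \<in> carrier R" "f x = f y" for x y
  proof -
    have *: "(x \<ominus> y) \<otimes> s \<in> D" if s: "s \<in> insert \<one> T" for s
    proof -
      have sc: "s \<in> carrier R" using s T by auto
      have e: "c (x \<otimes> s) = c (y \<otimes> s)"
        using fun_cong[OF xy(3), of s] s by (simp add: f_def)
      have cc: "c (y \<otimes> s) \<in> carrier R" using c(1)[of "y \<otimes> s"] sc xy T by auto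
      have "(x \<otimes> s \<ominus> c (x \<otimes> s)) \<ominus> (y \<otimes> s \<ominus> c (y \<otimes> s)) \<in> D"
        using c(2)[of "x \<otimes> s"] c(2)[of "y \<otimes> s"] xy sc DD(6) by simp
      also have "(x \<otimes> s \<ominus> c (x \<otimes> s)) \<ominus> (y \<otimes> s \<ominus> c (y \<otimes> s)) = (x \<ominus> y) \<otimes> s"
        unfolding e using xy sc cc by algebra
      finally show ?thesis .
    qed
    have d: "x \<ominus> y \<in> D" using *[of \<one>] xy by simp
    have "(x \<ominus> y) \<otimes> s \<in> D" if s: "s \<in> carrier R" for s
    proof -
      obtain t where t: "t \<in> T" "s \<ominus> t \<in> D" using cov s by blast
      have tc: "t \<in> carrier R" using t T by auto
      have "(x \<ominus> y) \<otimes> t \<oplus> (x \<ominus> y) \<otimes> (s \<ominus> t) \<in> D"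
        using * t d DD(4,7) by blast
      also have "(x \<ominus> y) \<otimes> t \<oplus> (x \<ominus> y) \<otimes> (s \<ominus> t) = (x \<ominus> y) \<otimes> s"
        using xy s tc by algebra
      finally show ?thesis .
    qed
    then have "x \<ominus> y \<in> I"
      unfolding I_def using minus_closed[OF xy(1,2)] by blast
    then show ?thesis
      using quotient_eq_iff_same_a_r_cos[OF ideal xy(1,2)] by simp
  qed
  have "f ` carrier R \<subseteq> insert \<one> T \<rightarrow>\<^sub>E T"
    unfolding f_def image_subset_iff restrict_PiE_iff
  proof (intro ballI)
    fix x s assume "x \<in> carrier R" "s \<in> insert \<one> T"
    then have "x \<otimes> s \<in> carrier R" using T(2) by auto
    then show "c (x \<otimes> s) \<in> T" by (rule c(1))
  qed
  then have finf: "finite (f ` carrier R)"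
    using T(1) by (meson finite_PiE finite_insert finite_subset)
  define g where "g v = I +> (SOME x. x \<in> carrier R \<and> f x = v)" for v
  have "I +> x = g (f x)" if x: "x \<in> carrier R" for x
  proof -
    have "\<exists>y. y \<in> carrier R \<and> f y = f x" using x by blast
    from someI_ex[OF this] show ?thesis
      unfolding g_def by (intro same) (use x in simp_all)
  qed
  then have "carrier (R Quot I) \<subseteq> g ` f ` carrier R"
    by (auto simp: FactRing_simps)
  then have "finite (carrier (R Quot I))"
    using finf finite_surj by blast
  with ideal sub that show ?thesis by blast
qed

section \<open>Residue fields of maximal ideals\<close>

text \<open>Cauchy's theorem: Sylow's theorem applied with exponent 1, whether or not
  \<open>p\<close> divides the cofactor.\<close>

lemma (in group) exists_prime_order_element:
  assumes fin: "finite (carrier G)" and p: "Factorial_Ring.prime p" "p dvd order G"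
  obtains x where "x \<in> carrier G" "x \<noteq> \<one>" "x [^] p = \<one>"
proof -
  obtain m where "order G = p ^ 1 * m" using p(2) by (auto elim: dvdE)
  from sylow_thm[OF p(1) group_axioms this fin]
  obtain H where H: "subgroup H G" "card H = p" by auto
  interpret H: subgroup H G by fact
  interpret GH: group "G\<lparr>carrier := H\<rparr>" by (rule H.subgroup_is_group[OF group_axioms])
  have "\<not> H \<subseteq> {\<one>}"
  proof
    assume "H \<subseteq> {\<one>}"
    then have "card H \<le> card {\<one>}" by (intro card_mono) auto
    then show False using H(2) prime_gt_1_nat[OF p(1)] by simp
  qed
  then obtain x where x: "x \<in> H" "x \<noteq> \<one>" by blast
  have "x [^] p = \<one>"
    using GH.pow_order_eq_1[of x] x(1) H(2) by (simp add: order_def flip: nat_pow_consistent)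
  with x that show ?thesis using H.mem_carrier by blast
qed

lemma nat_prime_power_if_unique_prime_factor:
  fixes q :: nat
  assumes "1 < q" "\<And>a b. Factorial_Ring.prime a \<Longrightarrow> Factorial_Ring.prime b \<Longrightarrow> a dvd q \<Longrightarrow> b dvd q \<Longrightarrow> a = b"
  shows "\<exists>p d. Factorial_Ring.prime p \<and> 0 < d \<and> q = p ^ d"
proof -
  obtain p where p: "Factorial_Ring.prime p" "p dvd q"
    using prime_factor_nat[of q] assms(1) by auto
  obtain r where r: "q = p ^ multiplicity p q * r" "\<not> p dvd r"
    using multiplicity_decompose'[of q p] p assms(1) by (metis not_prime_unit not_less_zero)
  have "r = 1"
  proof (rule ccontr)
    assume "r \<noteq> 1"
    then obtain b where b: "Factorial_Ring.prime b" "b dvd r"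
      using prime_factor_nat by blast
    have "b dvd q" using b(2) r(1) dvd_mult by metis
    then have "p = b" using assms(2)[OF p(1) b(1) p(2)] by blast
    with b r(2) show False by blast
  qed
  moreover have "0 < multiplicity p q"
    using p assms(1) by (intro multiplicity_gt_zero_iff[THEN iffD2]) (auto simp: prime_gt_1_nat)
  ultimately show ?thesis using p(1) r(1) by auto
qed

lemma (in ring) card_add_pow:
  assumes "x \<in> carrier R"
  shows "[card (carrier R)] \<cdot> x = \<zero>"
  using add.pow_order_eq_1[of x] assms by (simp add: order_def add_pow_def)

context field
begin

text \<open>By Cauchy's theorem in the additive group, each prime dividing the order kills a nonzero
  element, hence kills \<open>\<one>\<close>. Two different primes would give
  \<open>\<one> = \<zero>\<close> by Bezout.\<close>

lemma finite_field_card_prime_power: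
  assumes fin: "finite (carrier R)"
  shows "\<exists>p d :: nat. Factorial_Ring.prime p \<and> 0 < d \<and> card (carrier R) = p ^ d"
proof (rule nat_prime_power_if_unique_prime_factor)
  have "card {\<zero>, \<one>} \<le> card (carrier R)"
    using fin by (intro card_mono) auto
  then show "1 < card (carrier R)" by simp
  have *: "[p] \<cdot> \<one> = \<zero>" if p: "Factorial_Ring.prime p" "p dvd card (carrier R)" for p :: nat
  proof -
    obtain x where x: "x \<in> carrier R" "x \<noteq> \<zero>" "[p] \<cdot> x = \<zero>"
      using add.exists_prime_order_element[of p] fin p by (auto simp: order_def add_pow_def)
    have "([p] \<cdot> \<one>) \<otimes> x = \<zero>"
      using x by (simp add: add_pow_ldistr)
    then show ?thesis
      using x integral[of "[p] \<cdot> \<one>" x] by simp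
  qed
  fix a b :: nat
  assume ab: "Factorial_Ring.prime a" "Factorial_Ring.prime b" "a dvd card (carrier R)" "b dvd card (carrier R)"
  show "a = b"
  proof (rule ccontr)
    assume "a \<noteq> b"
    then have "coprime a b" using ab primes_coprime by blast
    then obtain s t where st: "a * s = b * t + 1"
      using bezout_nat[of a b] ab by (auto simp: prime_gt_0_nat coprime_iff_gcd_eq_1)
    have m: "[(k * l)] \<cdot> \<one> = [l] \<cdot> ([k] \<cdot> \<one>)" for k l :: nat
      by (simp add: add.nat_pow_pow)
    have "\<zero> = [(a * s)] \<cdot> \<one>" using *[OF ab(1,3)] by (simp add: m)
    also have "\<dots> = [(b * t)] \<cdot> \<one> \<oplus> \<one>"
      unfolding st by simp
    also have "\<dots> = \<one>" using *[OF ab(2,4)] by (simp add: m)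
    finally show False by simp
  qed
qed

lemma finite_field_pow_card:
  assumes fin: "finite (carrier R)" and x: "x \<in> carrier R"
  shows "x [^] card (carrier R) = x"
proof (cases "x = \<zero>")
  case True
  have "card (carrier R) \<noteq> 0" using fin by auto
  then show ?thesis using True by (simp add: nat_pow_zero)
next
  case False
  interpret M: group "Multiplicative_Group.mult_of R" by (rule field_mult_group)
  have "x [^]\<^bsub>Multiplicative_Group.mult_of R\<^esub> order (Multiplicative_Group.mult_of R) = \<one>\<^bsub>Multiplicative_Group.mult_of R\<^esub>"
    using x False by (intro M.pow_order_eq_1) simp
  then have *: "x [^] (card (carrier R) - 1) = \<one>"
    using fin by (simp add: Multiplicative_Group.nat_pow_mult_of order_mult_of order_def)
  have "card (carrier R) = Suc (card (carrier R) - 1)"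
    using fin by (metis card_gt_0_iff empty_iff one_closed Suc_pred')
  then have "x [^] card (carrier R) = x [^] (card (carrier R) - 1) \<otimes> x"
    by (metis nat_pow_Suc)
  then show ?thesis using * x by simp
qed

end

section \<open>Maximal ideals and the Jacobson radical, handled by congruences\<close>

context cring
begin

lemma maximalideal_inverse_mod:
  assumes m: "maximalideal m R" and x: "x \<in> carrier R" "x \<notin> m"
  obtains s where "s \<in> carrier R" "\<one> \<ominus> s \<otimes> x \<in> m"
proof -
  interpret maximalideal m R by fact
  have I: "ideal (PIdl x) R" by (rule cgenideal_ideal[OF x(1)])
  note sum = nonunital_subring_add_ideal[OF ideal_nonunital_subring[OF is_ideal] I]
  have "ideal (m <+>\<^bsub>R\<^esub> PIdl x) R" by (rule add_ideals[OF is_ideal I])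
  then have "m <+>\<^bsub>R\<^esub> PIdl x = m \<or> m <+>\<^bsub>R\<^esub> PIdl x = carrier R"
    using I_maximal sum(2) nonunital_subringD(2)[OF sum(1)] by blast
  moreover have "x \<in> m <+>\<^bsub>R\<^esub> PIdl x"
    using sum(3) cgenideal_self[OF x(1)] by blast
  ultimately have "\<one> \<in> m <+>\<^bsub>R\<^esub> PIdl x" using x(2) by auto
  then obtain i s where s: "i \<in> m" "s \<in> carrier R" "\<one> = i \<oplus> s \<otimes> x"
    by (auto simp: set_add_def' cgenideal_def)
  have "i \<in> carrier R" using s(1) a_subset by blast
  then have "\<one> \<ominus> s \<otimes> x = i"
    unfolding s(3) using s(2) x(1) by algebra
  with s that show ?thesis by blast
qed

text \<open>Criterion for maximality without passing to the quotient field, used for preimages of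
  maximal ideals and for conductors.\<close>

lemma maximalideal_if_inverses_mod:
  assumes m: "ideal m R" and one: "\<one> \<notin> m"
    and inv: "\<And>x. x \<in> carrier R \<Longrightarrow> x \<notin> m \<Longrightarrow> \<exists>s\<in>carrier R. \<one> \<ominus> s \<otimes> x \<in> m"
  shows "maximalideal m R"
proof (rule maximalidealI[OF m])
  show "carrier R \<noteq> m" using one by auto
  fix K assume K: "ideal K R" "m \<subseteq> K" "K \<subseteq> carrier R"
  interpret K: ideal K R by fact
  show "K = m \<or> K = carrier R"
  proof (cases "K = m")
    case False
    then obtain x where x: "x \<in> K" "x \<notin> m" using K by blast
    then have xc: "x \<in> carrier R" using K by blast
    then obtain s where s: "s \<in> carrier R" "\<one> \<ominus> s \<otimes> x \<in> m" using inv x by blast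
    have "(\<one> \<ominus> s \<otimes> x) \<oplus> s \<otimes> x \<in> K"
      using s K(2) K.I_l_closed[OF x(1) s(1)] by blast
    also have "(\<one> \<ominus> s \<otimes> x) \<oplus> s \<otimes> x = \<one>"
      using s(1) xc by algebra
    finally show ?thesis using K.one_imp_carrier by blast
  qed simp
qed

lemma jacobson_radical_ideal: "ideal (jacobson_radical R) R"
proof (cases "{M. maximalideal M R} = {}")
  case True
  then show ?thesis using oneideal by (simp add: jacobson_radical_def)
next
  case False
  have "ideal (\<Inter>{M. maximalideal M R}) R"
    using False by (intro i_Intersect) (auto simp: maximalideal.axioms)
  moreover from False have "\<Inter>{M. maximalideal M R} \<subseteq> carrier R"
    using additive_subgroup.a_subset ideal.axioms(1) maximalideal.axioms(1) by blast
  ultimately show ?thesis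
    by (simp add: jacobson_radical_def Int_absorb1)
qed

end

lemma (in ring_hom_cring) maximalideal_vimage:
  assumes surj: "h ` carrier R = carrier S" and m: "maximalideal m S"
  shows "maximalideal {x \<in> carrier R. h x \<in> m} R"
proof (rule R.maximalideal_if_inverses_mod)
  interpret m: maximalideal m S by fact
  have one: "\<one>\<^bsub>S\<^esub> \<notin> m" using m.one_imp_carrier m.I_notcarr by blast
  show "ideal {x \<in> carrier R. h x \<in> m} R"
    using ring.ideal_vimage[OF m.is_ideal] by simp
  show "\<one>\<^bsub>R\<^esub> \<notin> {x \<in> carrier R. h x \<in> m}" using one by simp
  fix x assume x: "x \<in> carrier R" "x \<notin> {x \<in> carrier R. h x \<in> m}"
  then have "h x \<in> carrier S" "h x \<notin> m" by simp_all
  then obtain s where s: "s \<in> carrier S" "\<one>\<^bsub>S\<^esub> \<ominus>\<^bsub>S\<^esub> s \<otimes>\<^bsub>S\<^esub> h x \<in> m"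
    using S.maximalideal_inverse_mod[OF m] by blast
  then obtain r where r: "r \<in> carrier R" "s = h r" using surj by blast
  have "h (\<one>\<^bsub>R\<^esub> \<ominus>\<^bsub>R\<^esub> r \<otimes>\<^bsub>R\<^esub> x) = \<one>\<^bsub>S\<^esub> \<ominus>\<^bsub>S\<^esub> s \<otimes>\<^bsub>S\<^esub> h x"
    using r x(1) by (simp add: a_minus_def)
  then show "\<exists>s\<in>carrier R. \<one>\<^bsub>R\<^esub> \<ominus>\<^bsub>R\<^esub> s \<otimes>\<^bsub>R\<^esub> x \<in> {x \<in> carrier R. h x \<in> m}"
    using r x s by (intro bexI[of _ r]) auto
qed

text \<open>Maximal ideals of \<open>S\<close> pull back to maximal ideals of \<open>R\<close>. Only
  this inclusion is available in general; the image of the radical can be smaller than the radical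
  of \<open>S\<close>.\<close>

lemma (in ring_hom_cring) jacobson_radical_image:
  assumes surj: "h ` carrier R = carrier S" and x: "x \<in> jacobson_radical R"
  shows "h x \<in> jacobson_radical S"
proof -
  have xc: "x \<in> carrier R"
    using x by (simp add: jacobson_radical_def)
  have xm: "x \<in> M" if "maximalideal M R" for M
    using x that by (simp add: jacobson_radical_def)
  have "h x \<in> m" if "maximalideal m S" for m
    using xm[OF maximalideal_vimage[OF surj that]] by simp
  with xc show ?thesis by (simp add: jacobson_radical_def)
qed

section \<open>Finite commutative rings\<close>

locale finite_cring = cring +
  assumes finite_carrier: "finite (carrier R)"
begin

lemma exists_maximalideal:
  assumes "ideal I R" "I \<noteq> carrier R"
  obtains m where "maximalideal m R" "I \<subseteq> m"
proof -
  let ?A = "{K. ideal K R \<and> K \<noteq> carrier R}"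
  have sub: "K \<subseteq> carrier R" if "ideal K R" for K
    using that by (simp add: ideal.axioms(1) additive_subgroup.a_subset)
  then have "?A \<subseteq> Pow (carrier R)" by blast
  then have fin: "finite ?A"
    using finite_carrier by (simp add: finite_subset)
  have "I \<in> ?A" using assms by simp
  from finite_has_maximal2[OF fin this]
  obtain m where m: "m \<in> ?A" "I \<subseteq> m" "\<forall>K\<in>?A. m \<subseteq> K \<longrightarrow> m = K"
    by blast
  have "maximalideal m R"
  proof (rule maximalidealI)
    show "K = m \<or> K = carrier R" if "ideal K R" "m \<subseteq> K" for K
      using m(3) that by blast
  qed (use m(1) in auto)
  with m that show ?thesis by blast
qed

lemma finite_maximalideals: "finite {m. maximalideal m R}"
proof (rule finite_subset)
  show "{m. maximalideal m R} \<subseteq> Pow (carrier R)"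
    using additive_subgroup.a_subset ideal.axioms(1) maximalideal.axioms(1) by blast
qed (use finite_carrier in simp)

text \<open>Nakayama's lemma for a cyclic module: \<open>\<one> \<ominus> j\<close> lies in no
  maximal ideal, so it is a unit, and it kills \<open>a\<close>.\<close>

lemma jacobson_radical_fixes_only_zero:
  assumes j: "j \<in> jacobson_radical R" and a: "a \<in> carrier R" "j \<otimes> a = a"
  shows "a = \<zero>"
proof -
  have jc: "j \<in> carrier R" and jm: "\<And>M. maximalideal M R \<Longrightarrow> j \<in> M"
    using j by (auto simp: jacobson_radical_def)
  define u where "u = \<one> \<ominus> j"
  have uc: "u \<in> carrier R" using jc by (simp add: u_def)
  have "PIdl u = carrier R"
  proof (rule ccontr)
    assume "PIdl u \<noteq> carrier R"
    then obtain m where m: "maximalideal m R" "PIdl u \<subseteq> m"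
      using exists_maximalideal[OF cgenideal_ideal[OF uc]] by blast
    interpret maximalideal m R by fact
    have "u \<in> m" using m(2) cgenideal_self[OF uc] by blast
    then have "u \<oplus> j \<in> m" using jm[OF m(1)] by blast
    also have "u \<oplus> j = \<one>" unfolding u_def using jc by algebra
    finally show False using one_imp_carrier I_notcarr by blast
  qed
  then have "\<one> \<in> PIdl u" by simp
  then obtain r where r: "r \<in> carrier R" "\<one> = r \<otimes> u" by (auto simp: cgenideal_def)
  have "a = (r \<otimes> u) \<otimes> a" using l_one[OF a(1)] r(2) by simp
  also have "\<dots> = r \<otimes> (a \<ominus> j \<otimes> a)" unfolding u_def using r(1) a(1) jc by algebra
  also have "\<dots> = \<zero>" unfolding a(2) using r(1) a(1) by algebra
  finally show ?thesis .
qed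

text \<open>Multiply elements chosen from each \<open>m'\<close> outside \<open>m\<close>; primality
  of \<open>m\<close> keeps the product outside \<open>m\<close>. The element \<open>e\<close> need
  not be idempotent.\<close>

lemma exists_separating_element:
  assumes m: "maximalideal m R"
  obtains e where "e \<in> carrier R" "e \<notin> m" "\<And>m'. maximalideal m' R \<Longrightarrow> m' \<noteq> m \<Longrightarrow> e \<in> m'"
proof -
  interpret m: maximalideal m R by fact
  interpret mp: primeideal m R by (rule maximalideal_prime[OF m])
  have "\<exists>e\<in>carrier R. e \<notin> m \<and> (\<forall>m'\<in>F. e \<in> m')"
    if "finite F" "F \<subseteq> {m'. maximalideal m' R \<and> m' \<noteq> m}" for F
    using that
  proof (induction F rule: finite_induct)
    case empty
    have "\<one> \<notin> m" using m.one_imp_carrier m.I_notcarr by blast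
    then show ?case by blast
  next
    case (insert m' F)
    then obtain e where e: "e \<in> carrier R" "e \<notin> m" "\<forall>m'\<in>F. e \<in> m'" by blast
    from insert have m': "maximalideal m' R" "m' \<noteq> m" by auto
    interpret m': maximalideal m' R by fact
    have "\<not> m' \<subseteq> m"
      using m'.I_maximal[OF m.is_ideal] m' m.a_subset m.I_notcarr by blast
    then obtain f where f: "f \<in> m'" "f \<notin> m" by blast
    have fc: "f \<in> carrier R" using f(1) m'.a_subset by blast
    have "e \<otimes> f \<notin> m" using mp.I_prime[OF e(1) fc] e f by blast
    moreover have "e \<otimes> f \<in> K" if "K \<in> insert m' F" for K
    proof (cases "K = m'")
      case True
      then show ?thesis using m'.I_l_closed[OF f(1) e(1)] by simp
    next
      case False
      with that insert.prems have K: "K \<in> F" "maximalideal K R" by auto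
      interpret K: maximalideal K R by fact
      show ?thesis using K.I_r_closed e(3) K(1) fc by blast
    qed
    ultimately show ?case using e(1) fc by blast
  qed
  from this[of "{m'. maximalideal m' R \<and> m' \<noteq> m}"] finite_maximalideals that
  show ?thesis by (auto simp: finite_subset)
qed

text \<open>Facts about the field \<open>R / m\<close> restated as congruences in \<open>R\<close>.
  The second and third drive the Frobenius argument; the transversal indexes translates in the count
  and lines in the plane.\<close>

lemma residue_field:
  assumes m: "maximalideal m R"
  defines "q \<equiv> card (carrier (R Quot m))"
  shows residue_field_card_prime_power: "\<exists>p d. Factorial_Ring.prime p \<and> 0 < d \<and> q = p ^ d"
    and residue_field_pow_card: "x \<in> carrier R \<Longrightarrow> x [^] q \<ominus> x \<in> m"
    and residue_field_card_one: "[q] \<cdot> \<one> \<in> m"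
    and residue_field_transversal: "\<exists>T. T \<subseteq> carrier R \<and> card T = q \<and> (\<forall>x\<in>carrier R. \<exists>t\<in>T. x \<ominus> t \<in> m)
      \<and> (\<forall>s\<in>T. \<forall>t\<in>T. s \<ominus> t \<in> m \<longrightarrow> s = t)"
proof -
  interpret m: maximalideal m R by fact
  have idl: "ideal m R" by (rule m.is_ideal)
  have car: "carrier (R Quot m) = (+>) m ` carrier R"
    by (auto simp: FactRing_simps)
  then have fin: "finite (carrier (R Quot m))"
    using finite_carrier by simp
  have zero: "\<zero>\<^bsub>R Quot m\<^esub> = m"
    by (simp add: FactRing_def)
  interpret F: field "R Quot m" by (rule m.quotient_is_field[OF is_cring])
  interpret h: ring_hom_ring R "R Quot m" "(+>) m" by (rule m.rcos_ring_hom_ring)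
  show "\<exists>p d. Factorial_Ring.prime p \<and> 0 < d \<and> q = p ^ d"
    unfolding q_def by (rule F.finite_field_card_prime_power[OF fin])
  show "x [^] q \<ominus> x \<in> m" if x: "x \<in> carrier R"
  proof -
    have "m +> (x [^] q) = (m +> x) [^]\<^bsub>R Quot m\<^esub> q"
      using x by (rule h.hom_nat_pow)
    also have "\<dots> = m +> x"
      unfolding q_def using F.finite_field_pow_card[OF fin] h.hom_closed[OF x] by blast
    finally show ?thesis
      using quotient_eq_iff_same_a_r_cos[OF idl nat_pow_closed[OF x] x] by blast
  qed
  have "m +> ([q] \<cdot> \<one>) = [q] \<cdot>\<^bsub>R Quot m\<^esub> \<one>\<^bsub>R Quot m\<^esub>"
    by (induction q) (simp_all)
  also have "\<dots> = \<zero>\<^bsub>R Quot m\<^esub>"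
    unfolding q_def by (rule F.card_add_pow[OF F.one_closed])
  also have "\<dots> = m" by (rule zero)
  finally have "m +> ([q] \<cdot> \<one>) = m" .
  then show "[q] \<cdot> \<one> \<in> m"
    using m.rcos_const_imp_mem add.nat_pow_closed[OF one_closed] by blast
  obtain T where T: "T \<subseteq> carrier R" "inj_on ((+>) m) T" "(+>) m ` carrier R = (+>) m ` T"
    using subset_image_inj[of "(+>) m ` carrier R" "(+>) m" "carrier R"] by auto
  have "card T = q"
    unfolding q_def car T(3) using T(2) by (simp add: card_image)
  moreover have "\<exists>t\<in>T. x \<ominus> t \<in> m" if x: "x \<in> carrier R" for x
  proof -
    have "m +> x \<in> (+>) m ` T" using x T(3) by blast
    then obtain t where t: "t \<in> T" "m +> x = m +> t" by blast
    then show ?thesis using quotient_eq_iff_same_a_r_cos[OF idl x] T(1) by blast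
  qed
  moreover have "s = t" if "s \<in> T" "t \<in> T" "s \<ominus> t \<in> m" for s t
  proof -
    have "m +> s = m +> t" using quotient_eq_iff_same_a_r_cos[OF idl] that T(1) by blast
    then show ?thesis using T(2) that by (simp add: inj_on_def)
  qed
  ultimately show "\<exists>T. T \<subseteq> carrier R \<and> card T = q \<and> (\<forall>x\<in>carrier R. \<exists>t\<in>T. x \<ominus> t \<in> m)
      \<and> (\<forall>s\<in>T. \<forall>t\<in>T. s \<ominus> t \<in> m \<longrightarrow> s = t)"
    using T(1) by blast
qed

end

section \<open>Maximal subrings not containing the Jacobson radical\<close>

definition maximal_nonunital_subring :: "'a set \<Rightarrow> ('a, 'm) ring_scheme \<Rightarrow> bool" where
  "maximal_nonunital_subring M R \<longleftrightarrow> nonunital_subring M R \<and> M \<noteq> carrier R \<and>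
     (\<forall>S. nonunital_subring S R \<longrightarrow> M \<subseteq> S \<longrightarrow> S = M \<or> S = carrier R)"

text \<open>
  If \<open>M\<close> is a maximal subring not containing the Jacobson radical \<open>J\<close>, then \<open>J / (M \<inter> J)\<close>
  is a simple module, and the following is the maximal ideal annihilating it.
\<close>

definition radical_conductor :: "'a set \<Rightarrow> ('a, 'm) ring_scheme \<Rightarrow> 'a set" where
  "radical_conductor M R = {r \<in> carrier R. \<forall>j\<in>jacobson_radical R. r \<otimes>\<^bsub>R\<^esub> j \<in> M}"

context finite_cring
begin

abbreviation "J \<equiv> jacobson_radical R"
abbreviation "K M \<equiv> radical_conductor M R"

lemma J_closed:
  shows "x \<in> J \<Longrightarrow> x \<in> carrier R"
    and "\<zero> \<in> J"
    and "x \<in> J \<Longrightarrow> y \<in> J \<Longrightarrow> x \<oplus> y \<in> J"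
    and "x \<in> J \<Longrightarrow> y \<in> J \<Longrightarrow> x \<ominus> y \<in> J"
    and "x \<in> J \<Longrightarrow> \<ominus> x \<in> J"
    and "r \<in> carrier R \<Longrightarrow> x \<in> J \<Longrightarrow> r \<otimes> x \<in> J"
    and "r \<in> carrier R \<Longrightarrow> x \<in> J \<Longrightarrow> x \<otimes> r \<in> J"
proof -
  note I = jacobson_radical_ideal
  note D = nonunital_subringD[OF ideal_nonunital_subring[OF I]]
  show "x \<in> J \<Longrightarrow> x \<in> carrier R" using D(2) by blast
  show "\<zero> \<in> J" by (rule D(3))
  show "x \<in> J \<Longrightarrow> y \<in> J \<Longrightarrow> x \<oplus> y \<in> J" by (rule D(4))
  show "x \<in> J \<Longrightarrow> y \<in> J \<Longrightarrow> x \<ominus> y \<in> J" by (rule D(6))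
  show "x \<in> J \<Longrightarrow> \<ominus> x \<in> J" by (rule D(5))
  show "r \<in> carrier R \<Longrightarrow> x \<in> J \<Longrightarrow> r \<otimes> x \<in> J" by (rule ideal.I_l_closed[OF I])
  show "r \<in> carrier R \<Longrightarrow> x \<in> J \<Longrightarrow> x \<otimes> r \<in> J" by (rule ideal.I_r_closed[OF I])
qed

lemma exists_maximal_nonunital_subring:
  assumes "nonunital_subring S R" "S \<noteq> carrier R"
  obtains M where "maximal_nonunital_subring M R" "S \<subseteq> M"
proof -
  let ?A = "{S. nonunital_subring S R \<and> S \<noteq> carrier R}"
  have "?A \<subseteq> Pow (carrier R)" using nonunital_subringD(2) by blast
  then have fin: "finite ?A"
    using finite_carrier by (simp add: finite_subset)
  have "S \<in> ?A" using assms by simp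
  from finite_has_maximal2[OF fin this]
  obtain M where M: "M \<in> ?A" "S \<subseteq> M" "\<forall>K\<in>?A. M \<subseteq> K \<longrightarrow> M = K"
    by blast
  then have "maximal_nonunital_subring M R"
    unfolding maximal_nonunital_subring_def by blast
  with M that show ?thesis by blast
qed

end

section \<open>A single maximal subring that does not contain the radical\<close>

locale radical_avoiding_subring = finite_cring +
  fixes M
  assumes maximal: "maximal_nonunital_subring M R"
    and avoids: "\<not> jacobson_radical R \<subseteq> M"
begin

lemma M_subring: "nonunital_subring M R"
  using maximal by (simp add: maximal_nonunital_subring_def)

lemma M_closed:
  shows "x \<in> M \<Longrightarrow> x \<in> carrier R"
    and "\<zero> \<in> M"
    and "x \<in> M \<Longrightarrow> y \<in> M \<Longrightarrow> x \<oplus> y \<in> M"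
    and "x \<in> M \<Longrightarrow> y \<in> M \<Longrightarrow> x \<ominus> y \<in> M"
    and "x \<in> M \<Longrightarrow> \<ominus> x \<in> M"
    and "x \<in> M \<Longrightarrow> y \<in> M \<Longrightarrow> x \<otimes> y \<in> M"
proof -
  note D = nonunital_subringD[OF M_subring]
  show "x \<in> M \<Longrightarrow> x \<in> carrier R" using D(2) by blast
  show "\<zero> \<in> M" by (rule D(3))
  show "x \<in> M \<Longrightarrow> y \<in> M \<Longrightarrow> x \<oplus> y \<in> M" by (rule D(4))
  show "x \<in> M \<Longrightarrow> y \<in> M \<Longrightarrow> x \<ominus> y \<in> M" by (rule D(6))
  show "x \<in> M \<Longrightarrow> \<ominus> x \<in> M" by (rule D(5))
  show "x \<in> M \<Longrightarrow> y \<in> M \<Longrightarrow> x \<otimes> y \<in> M" by (rule D(7))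
qed

lemma M_add_cancel:
  assumes "x \<oplus> y \<in> M" "x \<in> M" "y \<in> carrier R"
  shows "y \<in> M"
proof -
  have "(x \<oplus> y) \<ominus> x \<in> M" using assms M_closed(4) by blast
  also have "(x \<oplus> y) \<ominus> x = y" using M_closed(1)[OF assms(2)] assms(3) by algebra
  finally show ?thesis .
qed

text \<open>\<open>M + I\<close> is a subring strictly above \<open>M\<close>, hence everything by
  maximality.\<close>

lemma add_ideal_decomposition:
  assumes I: "ideal I R" "\<not> I \<subseteq> M" and x: "x \<in> carrier R"
  obtains m i where "m \<in> M" "i \<in> I" "x = m \<oplus> i"
proof -
  note sum = nonunital_subring_add_ideal[OF M_subring I(1)]
  have "M <+>\<^bsub>R\<^esub> I \<noteq> M" using sum(3) I(2) by blast
  then have "M <+>\<^bsub>R\<^esub> I = carrier R"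
    using maximal sum(1,2) unfolding maximal_nonunital_subring_def by blast
  then have "x \<in> M <+>\<^bsub>R\<^esub> I" using x by simp
  then show ?thesis using that unfolding set_add_def' by blast
qed

lemma add_multiple_decomposition:
  assumes a: "a \<in> carrier R" "a \<notin> M" and x: "x \<in> carrier R"
  obtains m r where "m \<in> M" "r \<in> carrier R" "x = m \<oplus> r \<otimes> a"
proof -
  have "\<not> PIdl a \<subseteq> M" using cgenideal_self[OF a(1)] a(2) by blast
  from add_ideal_decomposition[OF cgenideal_ideal[OF a(1)] this x]
  show ?thesis using that unfolding cgenideal_def by blast
qed

lemma add_radical_decomposition:
  assumes x: "x \<in> carrier R"
  obtains m j where "m \<in> M" "j \<in> J" "x = m \<oplus> j"
  using add_ideal_decomposition[OF jacobson_radical_ideal avoids x] .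

text \<open>
  Take \<open>a\<close> with minimal principal ideal. If \<open>j \<otimes> a \<notin> M\<close>, then \<open>a\<close> is a multiple of \<open>j \<otimes> a\<close>, which
  forces \<open>a = \<zero>\<close> as in Nakayama's lemma.
\<close>

lemma exists_radical_multiples_in_M:
  obtains a where "a \<in> J" "a \<notin> M" "\<And>j. j \<in> J \<Longrightarrow> j \<otimes> a \<in> M"
proof -
  obtain a0 where "a0 \<in> J \<and> a0 \<notin> M" using avoids by blast
  from ex_has_least_nat[of "\<lambda>a. a \<in> J \<and> a \<notin> M", OF this, of "\<lambda>a. card (PIdl a)"]
  obtain a where a: "a \<in> J" "a \<notin> M"
    and min: "\<And>b. b \<in> J \<Longrightarrow> b \<notin> M \<Longrightarrow> card (PIdl a) \<le> card (PIdl b)"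
    by blast
  note ac = J_closed(1)[OF a(1)]
  have "j \<otimes> a \<in> M" if j: "j \<in> J" for j
  proof (rule ccontr)
    assume notin: "j \<otimes> a \<notin> M"
    note jc = J_closed(1)[OF j]
    have jaJ: "j \<otimes> a \<in> J" using J_closed(6)[OF jc a(1)] .
    have "j \<otimes> a \<in> PIdl a" unfolding cgenideal_def using jc by blast
    then have sub: "PIdl (j \<otimes> a) \<subseteq> PIdl a"
      by (rule cgenideal_minimal[OF cgenideal_ideal[OF ac]])
    have "finite (PIdl a)"
      using finite_carrier nonunital_subringD(2)[OF ideal_nonunital_subring[OF cgenideal_ideal[OF ac]]]
      by (rule finite_subset[rotated])
    from card_seteq[OF this sub min[OF jaJ notin]]
    have "a \<in> PIdl (j \<otimes> a)" using cgenideal_self[OF ac] by simp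
    then obtain r where r: "r \<in> carrier R" "a = r \<otimes> (j \<otimes> a)"
      unfolding cgenideal_def by blast
    have "(r \<otimes> j) \<otimes> a = a" using m_assoc[OF r(1) jc ac] r(2) by simp
    then have "a = \<zero>"
      by (rule jacobson_radical_fixes_only_zero[OF J_closed(6)[OF r(1) j] ac])
    with a(2) M_closed(2) show False by simp
  qed
  with a that show ?thesis by blast
qed

text \<open>Writing \<open>i = m + r a\<close> and \<open>j = m' + r' a\<close>, both
  \<open>m\<close> and \<open>m'\<close> lie in \<open>J \<inter> M\<close>. In the expanded product
  \<open>m m'\<close> is in \<open>M\<close> by closure, and every other term is \<open>a\<close>
  times an element of \<open>J\<close>.\<close>

lemma radical_mult_radical_in_M:
  assumes i: "i \<in> J" and j: "j \<in> J"
  shows "i \<otimes> j \<in> M"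
proof -
  obtain a where a: "a \<in> J" "a \<notin> M" and ja: "\<And>j. j \<in> J \<Longrightarrow> j \<otimes> a \<in> M"
    by (rule exists_radical_multiples_in_M) blast
  note ac = J_closed(1)[OF a(1)]
  obtain m r where m: "m \<in> M" "r \<in> carrier R" "i = m \<oplus> r \<otimes> a"
    using add_multiple_decomposition[OF ac a(2) J_closed(1)[OF i]] by blast
  obtain m' r' where m': "m' \<in> M" "r' \<in> carrier R" "j = m' \<oplus> r' \<otimes> a"
    using add_multiple_decomposition[OF ac a(2) J_closed(1)[OF j]] by blast
  note c = M_closed(1)[OF m(1)] M_closed(1)[OF m'(1)] m(2) m'(2) ac
  have mJ: "m \<in> J"
  proof -
    have "i \<ominus> r \<otimes> a \<in> J" using J_closed(4)[OF i J_closed(6)[OF m(2) a(1)]] .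
    also have "i \<ominus> r \<otimes> a = m" unfolding m(3) using c by algebra
    finally show ?thesis .
  qed
  have m'J: "m' \<in> J"
  proof -
    have "j \<ominus> r' \<otimes> a \<in> J" using J_closed(4)[OF j J_closed(6)[OF m'(2) a(1)]] .
    also have "j \<ominus> r' \<otimes> a = m'" unfolding m'(3) using c by algebra
    finally show ?thesis .
  qed
  have 1: "(m \<otimes> r') \<otimes> a \<in> M" using ja[OF J_closed(7)[OF m'(2) mJ]] .
  have 2: "(m' \<otimes> r) \<otimes> a \<in> M" using ja[OF J_closed(7)[OF m(2) m'J]] .
  have 3: "((r \<otimes> r') \<otimes> a) \<otimes> a \<in> M"
    using ja[OF J_closed(6)[OF m_closed[OF m(2) m'(2)] a(1)]] .
  have "m \<otimes> m' \<oplus> ((m \<otimes> r') \<otimes> a \<oplus> ((m' \<otimes> r) \<otimes> a \<oplus> ((r \<otimes> r') \<otimes> a) \<otimes> a)) \<in> M"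
    using M_closed(3)[OF M_closed(6)[OF m(1) m'(1)] M_closed(3)[OF 1 M_closed(3)[OF 2 3]]] .
  also have "m \<otimes> m' \<oplus> ((m \<otimes> r') \<otimes> a \<oplus> ((m' \<otimes> r) \<otimes> a \<oplus> ((r \<otimes> r') \<otimes> a) \<otimes> a)) = i \<otimes> j"
    unfolding m(3) m'(3) using c by algebra
  finally show ?thesis .
qed

text \<open>This makes \<open>M \<inter> J\<close> an ideal of \<open>R\<close>: split
  \<open>r\<close> along \<open>M + J\<close>; the \<open>M\<close>-part is handled by closure, the
  \<open>J\<close>-part by the preceding inclusion.\<close>

lemma mult_radical_part_in_M:
  assumes r: "r \<in> carrier R" and n: "n \<in> J" "n \<in> M"
  shows "r \<otimes> n \<in> M"
proof -
  obtain m j where m: "m \<in> M" "j \<in> J" "r = m \<oplus> j"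
    by (rule add_radical_decomposition[OF r])
  have "m \<otimes> n \<oplus> j \<otimes> n \<in> M"
    using M_closed(3)[OF M_closed(6)[OF m(1) n(2)] radical_mult_radical_in_M[OF m(2) n(1)]] .
  also have "m \<otimes> n \<oplus> j \<otimes> n = r \<otimes> n"
    unfolding m(3) using M_closed(1)[OF m(1)] J_closed(1)[OF m(2)] J_closed(1)[OF n(1)] by algebra
  finally show ?thesis .
qed

text \<open>Simplicity of \<open>J / (M \<inter> J)\<close>: every element outside \<open>M\<close>
  generates it.\<close>

lemma radical_decomposition:
  assumes a: "a \<in> J" "a \<notin> M" and j: "j \<in> J"
  obtains n r where "n \<in> J" "n \<in> M" "r \<in> carrier R" "j = n \<oplus> r \<otimes> a"
proof -
  obtain n r where n: "n \<in> M" "r \<in> carrier R" "j = n \<oplus> r \<otimes> a"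
    using add_multiple_decomposition[OF J_closed(1)[OF a(1)] a(2) J_closed(1)[OF j]] by blast
  have "j \<ominus> r \<otimes> a \<in> J" using J_closed(4)[OF j J_closed(6)[OF n(2) a(1)]] .
  also have "j \<ominus> r \<otimes> a = n"
    unfolding n(3) using M_closed(1)[OF n(1)] n(2) J_closed(1)[OF a(1)] by algebra
  finally show ?thesis using that n by blast
qed

text \<open>Take \<open>j0\<close> in \<open>J\<close> with \<open>r \<otimes> j0\<close> outside
  \<open>M\<close>. By simplicity \<open>j0\<close> is a multiple \<open>s r j0\<close> modulo
  \<open>M \<inter> J\<close>, so \<open>\<one> \<ominus> s \<otimes> r\<close> kills
  \<open>j0\<close>; as \<open>j0\<close> generates \<open>J\<close> modulo
  \<open>M \<inter> J\<close>, it kills everything.\<close>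

lemma conductor_inverse:
  assumes r: "r \<in> carrier R" "r \<notin> K M"
  obtains s where "s \<in> carrier R" "\<one> \<ominus> s \<otimes> r \<in> K M"
proof -
  obtain j0 where j0: "j0 \<in> J" "r \<otimes> j0 \<notin> M"
    using r by (auto simp: radical_conductor_def)
  note j0c = J_closed(1)[OF j0(1)]
  have j0M: "j0 \<notin> M" using mult_radical_part_in_M[OF r(1) j0(1)] j0(2) by blast
  obtain n s where s: "n \<in> J" "n \<in> M" "s \<in> carrier R" "j0 = n \<oplus> s \<otimes> (r \<otimes> j0)"
    using radical_decomposition[OF J_closed(6)[OF r(1) j0(1)] j0(2) j0(1)] by blast
  define u where "u = \<one> \<ominus> s \<otimes> r"
  have uc: "u \<in> carrier R" using s(3) r(1) by (simp add: u_def)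
  have "u \<otimes> j0 = j0 \<ominus> s \<otimes> (r \<otimes> j0)" unfolding u_def using s(3) r(1) j0c by algebra
  also have "\<dots> = (n \<oplus> s \<otimes> (r \<otimes> j0)) \<ominus> s \<otimes> (r \<otimes> j0)" using s(4) by simp
  also have "\<dots> = n" using s(3) r(1) j0c J_closed(1)[OF s(1)] by algebra
  finally have uj0: "u \<otimes> j0 \<in> M" using s(2) by simp
  have "u \<otimes> j \<in> M" if j: "j \<in> J" for j
  proof -
    obtain n' t where t: "n' \<in> J" "n' \<in> M" "t \<in> carrier R" "j = n' \<oplus> t \<otimes> j0"
      by (rule radical_decomposition[OF j0(1) j0M j])
    have "u \<otimes> n' \<oplus> t \<otimes> (u \<otimes> j0) \<in> M"
      using M_closed(3)[OF mult_radical_part_in_M[OF uc t(1,2)]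
          mult_radical_part_in_M[OF t(3) J_closed(6)[OF uc j0(1)] uj0]] .
    also have "u \<otimes> n' \<oplus> t \<otimes> (u \<otimes> j0) = u \<otimes> j"
      unfolding t(4) using uc t(3) j0c J_closed(1)[OF t(1)] by algebra
    finally show ?thesis .
  qed
  then have "u \<in> K M" using uc by (simp add: radical_conductor_def)
  then show ?thesis using that s(3) u_def by blast
qed

lemma conductor_ideal: "ideal (K M) R"
proof (rule idealI)
  show "subgroup (K M) (add_monoid R)"
  proof
    show "K M \<subseteq> carrier (add_monoid R)" by (auto simp: radical_conductor_def)
    show "\<one>\<^bsub>add_monoid R\<^esub> \<in> K M"
      using M_closed(2) J_closed(1) by (simp add: radical_conductor_def)
  next
    fix x y assume "x \<in> K M" "y \<in> K M"
    then show "x \<otimes>\<^bsub>add_monoid R\<^esub> y \<in> K M"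
      using M_closed(3) J_closed(1) by (simp add: radical_conductor_def l_distr)
  next
    fix x assume "x \<in> K M"
    then have "\<ominus> x \<in> K M"
      using M_closed(5) J_closed(1) by (simp add: radical_conductor_def l_minus)
    then show "inv\<^bsub>add_monoid R\<^esub> x \<in> K M" by (simp add: a_inv_def)
  qed
next
  fix a x assume a: "a \<in> K M" and x: "x \<in> carrier R"
  have ac: "a \<in> carrier R" using a by (simp add: radical_conductor_def)
  have "(x \<otimes> a) \<otimes> j \<in> M" if j: "j \<in> J" for j
  proof -
    have "a \<otimes> (x \<otimes> j) \<in> M"
      using a J_closed(6)[OF x j] by (simp add: radical_conductor_def)
    also have "a \<otimes> (x \<otimes> j) = (x \<otimes> a) \<otimes> j" using ac x J_closed(1)[OF j] by algebra
    finally show ?thesis .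
  qed
  then show "x \<otimes> a \<in> K M" using x ac by (simp add: radical_conductor_def)
  then show "a \<otimes> x \<in> K M" using m_comm[OF ac x] by simp
qed (rule ring_axioms)

lemma conductor_maximalideal: "maximalideal (K M) R"
proof (rule maximalideal_if_inverses_mod[OF conductor_ideal])
  show "\<one> \<notin> K M"
  proof
    assume "\<one> \<in> K M"
    then have "\<And>j. j \<in> J \<Longrightarrow> \<one> \<otimes> j \<in> M" by (simp add: radical_conductor_def)
    then have "J \<subseteq> M" using l_one J_closed(1) by fastforce
    with avoids show False ..
  qed
  show "\<exists>s\<in>carrier R. \<one> \<ominus> s \<otimes> x \<in> K M" if "x \<in> carrier R" "x \<notin> K M" for x
    using conductor_inverse[OF that] by blast
qed

lemma conductor_mult_radical: "r \<in> K M \<Longrightarrow> j \<in> J \<Longrightarrow> r \<otimes> j \<in> M"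
  by (simp add: radical_conductor_def)

text \<open>An element outside the conductor acts invertibly on \<open>J / (M \<inter> J)\<close>,
  through its inverse modulo \<open>K M\<close>.\<close>

lemma conductor_cancel:
  assumes r: "r \<in> carrier R" "r \<notin> K M" and j: "j \<in> J" "r \<otimes> j \<in> M"
  shows "j \<in> M"
proof -
  obtain s where s: "s \<in> carrier R" "\<one> \<ominus> s \<otimes> r \<in> K M"
    by (rule conductor_inverse[OF r])
  have "(\<one> \<ominus> s \<otimes> r) \<otimes> j \<oplus> s \<otimes> (r \<otimes> j) \<in> M"
    using M_closed(3)[OF conductor_mult_radical[OF s(2) j(1)]
        mult_radical_part_in_M[OF s(1) J_closed(6)[OF r(1) j(1)] j(2)]] .
  also have "(\<one> \<ominus> s \<otimes> r) \<otimes> j \<oplus> s \<otimes> (r \<otimes> j) = j"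
    using s(1) r(1) J_closed(1)[OF j(1)] by algebra
  finally show ?thesis .
qed

text \<open>The binomial expansion to first order, since \<open>J \<otimes> J \<subseteq> M\<close>.\<close>

lemma pow_Suc_add_radical:
  assumes a: "a \<in> carrier R" and d: "d \<in> J"
  shows "\<exists>n\<in>J \<inter> M. (a \<oplus> d) [^] Suc k = a [^] Suc k \<oplus> ([Suc k] \<cdot> \<one>) \<otimes> (a [^] k \<otimes> d) \<oplus> n"
proof (induction k)
  case 0
  have "(a \<oplus> d) [^] Suc 0 = a [^] Suc 0 \<oplus> ([Suc 0] \<cdot> \<one>) \<otimes> (a [^] (0::nat) \<otimes> d) \<oplus> \<zero>"
    using a J_closed(1)[OF d] by simp
  then show ?case using J_closed(2) M_closed(2) by blast
next
  case (Suc k)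
  then obtain n where n: "n \<in> J" "n \<in> M"
    "(a \<oplus> d) [^] Suc k = a [^] Suc k \<oplus> ([Suc k] \<cdot> \<one>) \<otimes> (a [^] k \<otimes> d) \<oplus> n" by blast
  define p c where "p = a [^] k" and "c = [Suc k] \<cdot> \<one>"
  have car: "p \<in> carrier R" "c \<in> carrier R" "a \<in> carrier R" "d \<in> carrier R" "n \<in> carrier R"
    using a J_closed(1)[OF d] J_closed(1)[OF n(1)] by (simp_all add: p_def c_def)
  have cpd: "(c \<otimes> p) \<otimes> d \<in> J" using car d J_closed(6) by simp
  define n' where "n' = ((c \<otimes> p) \<otimes> d) \<otimes> d \<oplus> (a \<oplus> d) \<otimes> n"
  have "n' \<in> J"
    unfolding n'_def using car d n(1) cpd J_closed by simp
  moreover have "n' \<in> M"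
    unfolding n'_def
    using M_closed(3)[OF radical_mult_radical_in_M[OF cpd d] mult_radical_part_in_M[OF _ n(1,2)]] car
    by simp
  moreover have "(a \<oplus> d) [^] Suc (Suc k) = a [^] Suc (Suc k) \<oplus> ([Suc (Suc k)] \<cdot> \<one>) \<otimes> (a [^] Suc k \<otimes> d) \<oplus> n'"
  proof -
    have "(a \<oplus> d) [^] Suc (Suc k) = (p \<otimes> a \<oplus> c \<otimes> (p \<otimes> d) \<oplus> n) \<otimes> (a \<oplus> d)"
      using n(3) by (simp add: p_def c_def)
    also have "\<dots> = (p \<otimes> a) \<otimes> a \<oplus> (c \<oplus> \<one>) \<otimes> ((p \<otimes> a) \<otimes> d) \<oplus> n'"
      unfolding n'_def using car by algebra
    finally show ?thesis by (simp add: p_def c_def)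
  qed
  ultimately show ?case by blast
qed

abbreviation "q \<equiv> card (carrier (R Quot K M))"

lemma q_pos: "0 < q"
  using residue_field_card_prime_power[OF conductor_maximalideal] prime_gt_0_nat by fastforce

text \<open>The linear term of the expansion has coefficient \<open>[q] \<cdot> \<one>\<close>,
  which lies in \<open>K M\<close> and so sends \<open>J\<close> into \<open>M\<close>.\<close>

lemma pow_q_add_radical:
  assumes a: "a \<in> carrier R" and d: "d \<in> J"
  shows "(a \<oplus> d) [^] q \<ominus> a [^] q \<in> J \<inter> M"
proof -
  obtain k where k: "q = Suc k" using q_pos gr0_conv_Suc by blast
  obtain n where n: "n \<in> J" "n \<in> M"
    "(a \<oplus> d) [^] q = a [^] q \<oplus> ([q] \<cdot> \<one>) \<otimes> (a [^] k \<otimes> d) \<oplus> n"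
    using pow_Suc_add_radical[OF a d, of k] unfolding k by blast
  define c where "c = [q] \<cdot> \<one>"
  have cc: "c \<in> carrier R" by (simp add: c_def)
  have cK: "c \<in> K M" using residue_field_card_one[OF conductor_maximalideal] by (simp add: c_def)
  have adJ: "a [^] k \<otimes> d \<in> J" using J_closed(6) a d by simp
  define p where "p = a [^] q"
  have pc: "p \<in> carrier R" using a by (simp add: p_def)
  have "c \<otimes> (a [^] k \<otimes> d) \<oplus> n \<in> J \<inter> M"
    using M_closed(3)[OF conductor_mult_radical[OF cK adJ] n(2)]
      J_closed(3)[OF J_closed(6)[OF cc adJ] n(1)] by blast
  also have "c \<otimes> (a [^] k \<otimes> d) \<oplus> n = (p \<oplus> c \<otimes> (a [^] k \<otimes> d) \<oplus> n) \<ominus> p"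
    using cc pc J_closed(1)[OF adJ] J_closed(1)[OF n(1)] by algebra
  finally show ?thesis using n(3) by (simp add: c_def p_def)
qed

text \<open>Positive exponents only, since \<open>M\<close> need not contain
  \<open>\<one>\<close>.\<close>

lemma M_pow_Suc: "x \<in> M \<Longrightarrow> x [^] Suc k \<in> M"
  by (induction k) (use M_closed in auto)

end

section \<open>Comparison of two such subrings\<close>

locale radical_avoiding_pair =
  A: radical_avoiding_subring R M + B: radical_avoiding_subring R M' for R (structure) and M M'
begin

context
  assumes same: "M \<inter> A.J = M' \<inter> A.J"
begin

lemma conductor_eq: "A.K M = A.K M'"
proof -
  have "r \<otimes> j \<in> M \<longleftrightarrow> r \<otimes> j \<in> M'" if "r \<in> carrier R" "j \<in> A.J" for r j
    using same A.J_closed(6)[OF that] by blast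
  then show ?thesis unfolding radical_conductor_def by blast
qed

text \<open>
  Raising to the power \<open>q\<close> kills perturbations by \<open>J\<close> modulo \<open>M \<inter> J\<close>, so the representatives in \<open>M\<close>
  and \<open>M'\<close> of an element fixed by this power agree modulo \<open>M \<inter> J\<close>.
\<close>

lemma frobenius_fixed_mod_radical:
  assumes y: "y \<in> carrier R" "y [^] A.q \<ominus> y \<in> A.J"
  obtains a where "a \<in> M" "a \<in> M'" "y \<ominus> a \<in> A.J"
proof -
  obtain a j where a: "a \<in> M" "j \<in> A.J" "y = a \<oplus> j"
    by (rule A.add_radical_decomposition[OF y(1)])
  obtain a' j' where a': "a' \<in> M'" "j' \<in> A.J" "y = a' \<oplus> j'"
    by (rule B.add_radical_decomposition[OF y(1)])
  note ac = A.M_closed(1)[OF a(1)] and jc = A.J_closed(1)[OF a(2)]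
  note a'c = B.M_closed(1)[OF a'(1)] and j'c = A.J_closed(1)[OF a'(2)]
  obtain k where k: "A.q = Suc k" using A.q_pos gr0_conv_Suc by blast
  \<comment> \<open>Applies to \<open>a\<close> and to \<open>a'\<close>: both differ from
    \<open>y\<close> by an element of \<open>J\<close>, so they inherit the congruence assumed for
    \<open>y\<close>.\<close>
  have J: "b [^] A.q \<ominus> b \<in> A.J" if b: "b \<in> carrier R" "i \<in> A.J" "y = b \<oplus> i" for b i
  proof -
    note ic = A.J_closed(1)[OF b(2)]
    have "b [^] A.q \<in> carrier R" "y [^] A.q \<in> carrier R" using b y(1) by simp_all
    note car = this b(1) ic y(1)
    have "y \<oplus> \<ominus> i = b" unfolding b(3) using b(1) ic by algebra
    then have "b [^] A.q \<ominus> y [^] A.q \<in> A.J"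
      using A.pow_q_add_radical[OF y(1) A.J_closed(5)[OF b(2)]] by simp
    then have "(b [^] A.q \<ominus> y [^] A.q) \<oplus> ((y [^] A.q \<ominus> y) \<oplus> i) \<in> A.J"
      using A.J_closed(3)[OF _ A.J_closed(3)[OF y(2) b(2)]] by blast
    also have "(b [^] A.q \<ominus> y [^] A.q) \<oplus> ((y [^] A.q \<ominus> y) \<oplus> i) = b [^] A.q \<ominus> y \<oplus> i"
      using car by algebra
    also have "\<dots> = b [^] A.q \<ominus> b" unfolding b(3) using car(1,3,4) by algebra
    finally show ?thesis .
  qed
  have 1: "a [^] A.q \<ominus> a \<in> M"
    using A.M_closed(4)[OF A.M_pow_Suc[OF a(1)] a(1)] by (simp only: k)
  have "a' [^] A.q \<ominus> a' \<in> M'"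
    using B.M_closed(4)[OF B.M_pow_Suc[OF a'(1)] a'(1)] by (simp only: k)
  then have 2: "a' [^] A.q \<ominus> a' \<in> M"
    using J[OF a'c a'(2,3)] same by blast
  have "a \<oplus> (j \<ominus> j') = (a \<oplus> j) \<ominus> j'" using ac jc j'c by algebra
  also have "\<dots> = (a' \<oplus> j') \<ominus> j'" using a(3) a'(3) by simp
  also have "\<dots> = a'" using a'c j'c by algebra
  finally have 3: "a' [^] A.q \<ominus> a [^] A.q \<in> M"
    using A.pow_q_add_radical[OF ac A.J_closed(4)[OF a(2) a'(2)]] by simp
  have pc: "a [^] A.q \<in> carrier R" "a' [^] A.q \<in> carrier R" using ac a'c by simp_all
  \<comment> \<open>A telescoping expression for \<open>a'\<close> with all terms in
    \<open>M\<close>. The critical term \<open>a' [^] A.q \<ominus> a'\<close> lies in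
    \<open>M'\<close> by closure and in \<open>J\<close>, hence in \<open>M\<close> by the
    assumption on radical parts.\<close>
  have "((a' [^] A.q \<ominus> a [^] A.q) \<ominus> (a' [^] A.q \<ominus> a')) \<oplus> ((a [^] A.q \<ominus> a) \<oplus> a) \<in> M"
    using A.M_closed(3)[OF A.M_closed(4)[OF 3 2] A.M_closed(3)[OF 1 a(1)]] .
  also have "((a' [^] A.q \<ominus> a [^] A.q) \<ominus> (a' [^] A.q \<ominus> a')) \<oplus> ((a [^] A.q \<ominus> a) \<oplus> a) = a'"
    using pc ac a'c by algebra
  finally have "a' \<in> M" .
  moreover have "y \<ominus> a' = j'" unfolding a'(3) using a'c j'c by algebra
  ultimately show ?thesis using that a'(1,2) by simp
qed

text \<open>Both \<open>e\<close> and \<open>e \<otimes> x\<close> are fixed by the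
  \<open>q\<close>-th power modulo every maximal ideal, so they have lifts \<open>a\<close>,
  \<open>b\<close> in \<open>M \<inter> M'\<close> modulo \<open>J\<close>. Then
  \<open>a \<otimes> x \<ominus> b\<close> lies in \<open>M \<inter> J\<close>, hence in
  \<open>M'\<close>. With \<open>x = x' \<oplus> j\<close> and \<open>x'\<close> in
  \<open>M'\<close> this puts \<open>a \<otimes> j\<close> in \<open>M'\<close>, and
  \<open>a\<close> can be cancelled because it is outside the conductor.\<close>

lemma subset_if_same_radical_part: "M \<subseteq> M'"
proof
  fix x assume x: "x \<in> M"
  note xc = A.M_closed(1)[OF x]
  note mK = A.conductor_maximalideal
  obtain e where e: "e \<in> carrier R" "e \<notin> A.K M"
    and sep: "\<And>m. maximalideal m R \<Longrightarrow> m \<noteq> A.K M \<Longrightarrow> e \<in> m"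
    using A.exists_separating_element[OF mK] by blast
  have frob: "y [^] A.q \<ominus> y \<in> A.J"
    if y: "y \<in> carrier R" and ym: "\<And>m. maximalideal m R \<Longrightarrow> m \<noteq> A.K M \<Longrightarrow> y \<in> m" for y
  proof -
    have "y [^] A.q \<ominus> y \<in> m" if m: "maximalideal m R" for m
    proof (cases "m = A.K M")
      case True
      then show ?thesis using A.residue_field_pow_card[OF mK y] by simp
    next
      case False
      interpret m: maximalideal m R by fact
      have ymm: "y \<in> m" using ym m False by blast
      obtain k where k: "A.q = Suc k" using A.q_pos gr0_conv_Suc by blast
      have "y [^] A.q \<in> m"
        unfolding k nat_pow_Suc using m.I_l_closed[OF ymm A.nat_pow_closed[OF y]] by simp
      then show ?thesis
        using A.additive_subgroup_diff[OF m.is_additive_subgroup _ ymm] by blast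
    qed
    then show ?thesis using y by (simp add: jacobson_radical_def)
  qed
  have exm: "e \<otimes> x \<in> m" if m: "maximalideal m R" "m \<noteq> A.K M" for m
    using ideal.I_r_closed[OF maximalideal.axioms(1)[OF m(1)] sep[OF m] xc] .
  obtain a where a: "a \<in> M" "a \<in> M'" "e \<ominus> a \<in> A.J"
    by (rule frobenius_fixed_mod_radical[OF e(1) frob[OF e(1) sep]])
  obtain b where b: "b \<in> M" "b \<in> M'" "e \<otimes> x \<ominus> b \<in> A.J"
    by (rule frobenius_fixed_mod_radical[OF A.m_closed[OF e(1) xc] frob[OF A.m_closed[OF e(1) xc] exm]])
  obtain x' j where x': "x' \<in> M'" "j \<in> A.J" "x = x' \<oplus> j"
    by (rule B.add_radical_decomposition[OF xc])
  note car = A.M_closed(1)[OF a(1)] A.M_closed(1)[OF b(1)] B.M_closed(1)[OF x'(1)]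
    A.J_closed(1)[OF x'(2)] e(1) xc
  have "(e \<otimes> x \<ominus> b) \<ominus> (e \<ominus> a) \<otimes> x \<in> A.J"
    using A.J_closed(4)[OF b(3) A.J_closed(7)[OF xc a(3)]] .
  also have "(e \<otimes> x \<ominus> b) \<ominus> (e \<ominus> a) \<otimes> x = a \<otimes> x \<ominus> b" using car by algebra
  finally have "a \<otimes> x \<ominus> b \<in> A.J" .
  moreover have "a \<otimes> x \<ominus> b \<in> M" using A.M_closed(4)[OF A.M_closed(6)[OF a(1) x] b(1)] .
  ultimately have 1: "a \<otimes> x \<ominus> b \<in> M'" using same by blast
  have "(a \<otimes> x \<ominus> b) \<ominus> (a \<otimes> x' \<ominus> b) \<in> M'"
    using B.M_closed(4)[OF 1 B.M_closed(4)[OF B.M_closed(6)[OF a(2) x'(1)] b(2)]] .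
  also have "(a \<otimes> x \<ominus> b) \<ominus> (a \<otimes> x' \<ominus> b) = a \<otimes> j"
    unfolding x'(3) using car(1-4) by algebra
  finally have aj: "a \<otimes> j \<in> M'" .
  have aK: "a \<notin> A.K M"
  proof
    assume aK: "a \<in> A.K M"
    interpret K: ideal "A.K M" R by (rule A.conductor_ideal)
    have "e \<ominus> a \<in> A.K M" using a(3) mK by (simp add: jacobson_radical_def)
    then have "(e \<ominus> a) \<oplus> a \<in> A.K M" using aK by blast
    also have "(e \<ominus> a) \<oplus> a = e" using car by algebra
    finally show False using e(2) by simp
  qed
  have "j \<in> M'"
    using B.conductor_cancel[OF car(1) _ x'(2) aj] aK conductor_eq by blast
  then show "x \<in> M'" unfolding x'(3) using B.M_closed(3)[OF x'(1)] by blast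
qed

lemma eq_if_same_radical_part: "M = M'"
  using A.maximal B.maximal subset_if_same_radical_part
  unfolding maximal_nonunital_subring_def by blast

end

text \<open>The radical parts are distinct, and neither contains the other: if
  \<open>M \<inter> J\<close> lay in \<open>M'\<close>, an element of \<open>M' \<inter> J\<close>
  outside \<open>M\<close> would generate the rest of \<open>J\<close> inside
  \<open>M'\<close>.\<close>

lemma radical_part_not_subset:
  assumes "M \<noteq> M'"
  obtains j where "j \<in> A.J" "j \<in> M" "j \<notin> M'"
proof -
  have "M \<inter> A.J \<noteq> M' \<inter> A.J" using eq_if_same_radical_part assms by blast
  have "\<not> M \<inter> A.J \<subseteq> M'"
  proof
    assume sub: "M \<inter> A.J \<subseteq> M'"
    then obtain a where a: "a \<in> A.J" "a \<in> M'" "a \<notin> M"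
      using \<open>M \<inter> A.J \<noteq> M' \<inter> A.J\<close> by blast
    have "j \<in> M'" if j: "j \<in> A.J" for j
    proof -
      obtain n r where n: "n \<in> A.J" "n \<in> M" "r \<in> carrier R" "j = n \<oplus> r \<otimes> a"
        by (rule A.radical_decomposition[OF a(1,3) j])
      have "n \<in> M'" using sub n(1,2) by blast
      then show ?thesis
        unfolding n(4) using B.M_closed(3) B.mult_radical_part_in_M[OF n(3) a(1,2)] by blast
    qed
    with B.avoids show False by blast
  qed
  with that show ?thesis by blast
qed

end

section \<open>The lower bound, by counting in a coset\<close>

context finite_cring
begin

lemma radical_avoiding_subringI:
  "maximal_nonunital_subring M R \<Longrightarrow> \<not> J \<subseteq> M \<Longrightarrow> radical_avoiding_subring R M"
  by unfold_locales

text \<open>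
  With \<open>x\<close> covered by \<open>M\<^sub>1\<close> only and \<open>e\<close> separating \<open>K M\<^sub>1\<close> from the other maximal ideals, the coset
  \<open>x + e J\<close> meets only those members of the cover that have the same conductor as \<open>M\<^sub>1\<close>, each of them
  in at most a fraction \<open>1 / q\<close> of its elements, and two of these pieces overlap.
\<close>

lemma radical_avoiding_cover_large:
  assumes cov: "\<Union>C = carrier R" and fin: "finite C"
    and max: "\<And>M. M \<in> C \<Longrightarrow> maximal_nonunital_subring M R"
    and M1: "M1 \<in> C" "\<not> J \<subseteq> M1" and irr: "\<Union>(C - {M1}) \<noteq> carrier R"
  shows "\<exists>M2\<in>C. M2 \<noteq> M1 \<and> \<not> J \<subseteq> M2 \<and> K M2 = K M1"
    and "card (carrier (R Quot K M1)) < card C"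
proof -
  interpret A: radical_avoiding_subring R M1
    by (rule radical_avoiding_subringI[OF max[OF M1(1)] M1(2)])
  note mK = A.conductor_maximalideal
  obtain e where e: "e \<in> carrier R" "e \<notin> K M1"
    and sep: "\<And>m. maximalideal m R \<Longrightarrow> m \<noteq> K M1 \<Longrightarrow> e \<in> m"
    using exists_separating_element[OF mK] by blast
  obtain x where x: "x \<in> carrier R" "\<And>M. M \<in> C \<Longrightarrow> M \<noteq> M1 \<Longrightarrow> x \<notin> M"
    using irr cov by blast
  have x1: "x \<in> M1" using x cov by blast
  define W where "W = (\<lambda>j. e \<otimes> j) ` J"
  define B where "B = {M\<in>C. \<not> J \<subseteq> M \<and> K M = K M1}"
  have WJ: "w \<in> J" if "w \<in> W" for w
    using that J_closed(6)[OF e(1)] by (auto simp: W_def)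
  have Wadd: "v \<oplus> w \<in> W" if vw: "v \<in> W" "w \<in> W" for v w
  proof -
    obtain i j where ij: "i \<in> J" "j \<in> J" "v = e \<otimes> i" "w = e \<otimes> j"
      using vw unfolding W_def by blast
    then have "v \<oplus> w = e \<otimes> (i \<oplus> j)" using e(1) J_closed(1) by (simp add: r_distr)
    then show ?thesis unfolding W_def using J_closed(3)[OF ij(1,2)] by blast
  qed
  have Wmult: "r \<otimes> w \<in> W" if r: "r \<in> carrier R" and w: "w \<in> W" for r w
  proof -
    obtain j where j: "j \<in> J" "w = e \<otimes> j" using w unfolding W_def by blast
    have "r \<otimes> w = e \<otimes> (r \<otimes> j)"
      unfolding j(2) using r e(1) J_closed(1)[OF j(1)] by algebra
    then show ?thesis unfolding W_def using J_closed(6)[OF r j(1)] by blast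
  qed
  have finW: "finite W"
    using finite_carrier WJ J_closed(1) by (meson finite_subset subsetI)
  have finB: "finite B" using fin by (simp add: B_def)
  have Bavoid: "radical_avoiding_subring R M" if "M \<in> B" for M
    using that max by (auto simp: B_def intro: radical_avoiding_subringI)
  \<comment> \<open>A member outside \<open>B\<close> contains all of \<open>W\<close>: either it
    contains \<open>J\<close>, or its conductor contains \<open>e\<close>. If it contained
    \<open>x \<oplus> w\<close> it would contain \<open>x\<close>, which only \<open>M1\<close>
    does.\<close>
  have covW: "\<exists>M\<in>B. x \<oplus> w \<in> M" if w: "w \<in> W" for w
  proof -
    note wc = J_closed(1)[OF WJ[OF w]]
    have "x \<oplus> w \<in> \<Union>C" using cov x(1) wc by simp
    then obtain M where M: "M \<in> C" "x \<oplus> w \<in> M" by blast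
    have sub: "nonunital_subring M R"
      using max[OF M(1)] by (simp add: maximal_nonunital_subring_def)
    have "M \<in> B"
    proof (rule ccontr)
      assume notB: "M \<notin> B"
      then have ne: "M \<noteq> M1" using M1 by (auto simp: B_def)
      have "w \<in> M"
      proof (cases "J \<subseteq> M")
        case True
        then show ?thesis using WJ[OF w] by blast
      next
        case False
        interpret M: radical_avoiding_subring R M
          by (rule radical_avoiding_subringI[OF max[OF M(1)] False])
        have "K M \<noteq> K M1" using notB M(1) False by (simp add: B_def)
        then have "e \<in> K M" using sep[OF M.conductor_maximalideal] by blast
        then show ?thesis using w M.conductor_mult_radical by (auto simp: W_def)
      qed
      then have "(x \<oplus> w) \<ominus> w \<in> M" using nonunital_subringD(6)[OF sub M(2)] by blast
      also have "(x \<oplus> w) \<ominus> w = x" using x(1) wc by algebra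
      finally show False using x(2)[OF M(1) ne] by blast
    qed
    with M show ?thesis by blast
  qed
  have outside: "\<exists>w\<in>W. w \<notin> M" if M: "M \<in> B" for M
  proof -
    interpret M: radical_avoiding_subring R M by (rule Bavoid[OF M])
    obtain j where j: "j \<in> J" "j \<notin> M" using M.avoids by blast
    have "e \<notin> K M" using e(2) M by (simp add: B_def)
    then have "e \<otimes> j \<notin> M" using M.conductor_cancel[OF e(1) _ j(1)] j(2) by blast
    then show ?thesis using j(1) by (auto simp: W_def)
  qed
  have M1B: "M1 \<in> B" using M1 by (simp add: B_def)
  obtain w0 where w0: "w0 \<in> W" "w0 \<notin> M1" using outside[OF M1B] by blast
  note w0c = J_closed(1)[OF WJ[OF w0(1)]]
  obtain M2 where M2: "M2 \<in> B" "x \<oplus> w0 \<in> M2" using covW[OF w0(1)] by blast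
  have M2ne: "M2 \<noteq> M1" using A.M_add_cancel[OF _ x1 w0c] M2(2) w0(2) by blast
  show "\<exists>M2\<in>C. M2 \<noteq> M1 \<and> \<not> J \<subseteq> M2 \<and> K M2 = K M1"
    using M2(1) M2ne by (auto simp: B_def)
  interpret AB: radical_avoiding_pair R M1 M2
    by (intro radical_avoiding_pair.intro Bavoid M1B M2(1))
  obtain T where T: "T \<subseteq> carrier R" "card T = A.q"
    and Tinj: "\<And>s t. s \<in> T \<Longrightarrow> t \<in> T \<Longrightarrow> s \<ominus> t \<in> K M1 \<Longrightarrow> s = t"
    using residue_field_transversal[OF mK] by blast
  have finT: "finite T" using finite_subset[OF T(1) finite_carrier] .
  define P where "P M = {w\<in>W. x \<oplus> w \<in> M}" for M
  have finP: "finite (P M)" for M using finW by (simp add: P_def)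
  \<comment> \<open>With \<open>u\<close> in \<open>W\<close> outside \<open>M\<close>, the
    translates of \<open>P M\<close> by \<open>t \<otimes> u\<close>, for \<open>t\<close> in the
    transversal \<open>T\<close>, are \<open>q\<close> disjoint copies inside
    \<open>W\<close>.\<close>
  have Pcard: "A.q * card (P M) \<le> card W" if M: "M \<in> B" for M
  proof -
    interpret M: radical_avoiding_subring R M by (rule Bavoid[OF M])
    have KM: "K M = K M1" using M by (simp add: B_def)
    obtain u where u: "u \<in> W" "u \<notin> M" using outside[OF M] by blast
    note uJ = WJ[OF u(1)]
    note uc = J_closed(1)[OF uJ]
    let ?f = "\<lambda>(t, w). w \<oplus> t \<otimes> u"
    have "inj_on ?f (T \<times> P M)"
    proof (rule inj_onI)
      fix z z' assume z: "z \<in> T \<times> P M" "z' \<in> T \<times> P M" "?f z = ?f z'"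
      obtain t w t' w' where zz: "z = (t, w)" "z' = (t', w')" by (cases z, cases z') blast
      have tt: "t \<in> T" "t' \<in> T" and ww: "w \<in> W" "w' \<in> W" "x \<oplus> w \<in> M" "x \<oplus> w' \<in> M"
        and eq: "w \<oplus> t \<otimes> u = w' \<oplus> t' \<otimes> u"
        using z by (auto simp: zz P_def)
      have car: "t \<in> carrier R" "t' \<in> carrier R" "w \<in> carrier R" "w' \<in> carrier R"
        using tt T(1) J_closed(1)[OF WJ[OF ww(1)]] J_closed(1)[OF WJ[OF ww(2)]] by auto
      have "(t \<ominus> t') \<otimes> u = (w \<oplus> t \<otimes> u) \<ominus> w \<ominus> t' \<otimes> u" using car uc by algebra
      also have "\<dots> = (w' \<oplus> t' \<otimes> u) \<ominus> w \<ominus> t' \<otimes> u" unfolding eq ..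
      also have "\<dots> = (x \<oplus> w') \<ominus> (x \<oplus> w)" using car uc x(1) by algebra
      also have "\<dots> \<in> M" using M.M_closed(4)[OF ww(4,3)] .
      finally have "t \<ominus> t' \<in> K M"
        using M.conductor_cancel[OF minus_closed[OF car(1,2)] _ uJ] u(2) by blast
      then have tt': "t = t'" using Tinj tt KM by blast
      have "w = (w \<oplus> t \<otimes> u) \<ominus> t \<otimes> u" using car uc by algebra
      also have "\<dots> = (w' \<oplus> t' \<otimes> u) \<ominus> t' \<otimes> u" using eq tt' by simp
      also have "\<dots> = w'" using car uc by algebra
      finally show "z = z'" using tt' zz by simp
    qed
    moreover have "?f ` (T \<times> P M) \<subseteq> W"
    proof (rule image_subsetI)
      fix z assume z: "z \<in> T \<times> P M"
      obtain t w where tw: "z = (t, w)" by (cases z)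
      have "t \<in> carrier R" "w \<in> W" using z T(1) by (auto simp: tw P_def)
      then show "?f z \<in> W" using Wadd Wmult[OF _ u(1)] by (simp add: tw)
    qed
    ultimately have "card (T \<times> P M) \<le> card W" using card_inj_on_le finW by blast
    then show ?thesis using T(2) by (simp add: card_cartesian_product)
  qed
  \<comment> \<open>A common point of \<open>P M1\<close> and \<open>P M2\<close>: choose
    \<open>u\<close> in \<open>W\<close> inside \<open>M1\<close> but outside \<open>M2\<close>, and
    correct \<open>w0\<close> modulo \<open>M2\<close> to a multiple of \<open>u\<close>. The
    multiple stays in \<open>M1\<close>, and \<open>x \<oplus> w\<close> stays in
    \<open>M2\<close>.\<close>
  have overlap: "P M2 - P M1 \<subset> P M2"
  proof -
    obtain i where i: "i \<in> J" "i \<in> M1" "i \<notin> M2"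
      by (rule AB.radical_part_not_subset[OF M2ne[symmetric]])
    have K2: "K M2 = K M1" using M2(1) by (simp add: B_def)
    define u where "u = e \<otimes> i"
    have uW: "u \<in> W" using i(1) by (simp add: u_def W_def)
    note uJ = WJ[OF uW]
    have u1: "u \<in> M1" unfolding u_def by (rule A.mult_radical_part_in_M[OF e(1) i(1,2)])
    have u2: "u \<notin> M2"
      unfolding u_def using AB.B.conductor_cancel[OF e(1) _ i(1)] e(2) i(3) K2 by blast
    obtain n r where n: "n \<in> J" "n \<in> M2" "r \<in> carrier R" "w0 = n \<oplus> r \<otimes> u"
      by (rule AB.B.radical_decomposition[OF uJ u2 WJ[OF w0(1)]])
    define w where "w = r \<otimes> u"
    have wW: "w \<in> W" unfolding w_def by (rule Wmult[OF n(3) uW])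
    note wc = J_closed(1)[OF WJ[OF wW]]
    have w1: "w \<in> M1" unfolding w_def by (rule A.mult_radical_part_in_M[OF n(3) uJ u1])
    have "n \<oplus> (x \<oplus> w) = x \<oplus> w0"
      using n(4) wc J_closed(1)[OF n(1)] x(1) by (simp add: w_def[symmetric] a_ac)
    then have "x \<oplus> w \<in> M2"
      using AB.B.M_add_cancel[OF _ n(2) a_closed[OF x(1) wc]] M2(2) by simp
    then have "w \<in> P M2" using wW by (simp add: P_def)
    moreover have "w \<in> P M1" using wW A.M_closed(3)[OF x1 w1] by (simp add: P_def)
    ultimately show ?thesis by blast
  qed
  \<comment> \<open>The overlap is charged to \<open>M1\<close> only. The pieces still cover
    \<open>W\<close>, but the one of \<open>M2\<close> is strictly below \<open>card W / q\<close>,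
    which turns \<open>q \<le> card B\<close> into \<open>q < card B\<close>.\<close>
  define Q where "Q M = (if M = M2 then P M2 - P M1 else P M)" for M
  have finQ: "finite (Q M)" for M using finP by (simp add: Q_def)
  have "W \<subseteq> (\<Union>M\<in>B. Q M)"
  proof
    fix w assume w: "w \<in> W"
    then obtain M where M: "M \<in> B" "w \<in> P M" using covW by (auto simp: P_def)
    show "w \<in> (\<Union>M\<in>B. Q M)"
    proof (cases "w \<in> P M1")
      case True
      then have "w \<in> Q M1" using M2ne by (simp add: Q_def)
      then show ?thesis using M1B by blast
    next
      case False
      then have "w \<in> Q M" using M(2) by (auto simp: Q_def)
      then show ?thesis using M(1) by blast
    qed
  qed
  then have "card W \<le> card (\<Union>M\<in>B. Q M)"
    using finB finQ by (intro card_mono) auto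
  also have "\<dots> \<le> (\<Sum>M\<in>B. card (Q M))" by (rule card_UN_le[OF finB])
  finally have "A.q * card W \<le> (\<Sum>M\<in>B. A.q * card (Q M))"
    by (simp add: sum_distrib_left[symmetric])
  also have "\<dots> < (\<Sum>M\<in>B. card W)"
  proof (rule sum_strict_mono_ex1[OF finB])
    show "\<forall>M\<in>B. A.q * card (Q M) \<le> card W"
    proof
      fix M assume M: "M \<in> B"
      have "card (Q M) \<le> card (P M)" using finP by (intro card_mono) (auto simp: Q_def)
      then have "A.q * card (Q M) \<le> A.q * card (P M)" by simp
      then show "A.q * card (Q M) \<le> card W" using Pcard[OF M] by linarith
    qed
    have "card (Q M2) < card (P M2)"
      using psubset_card_mono[OF finP overlap] by (simp add: Q_def)
    then have "A.q * card (Q M2) < A.q * card (P M2)" using A.q_pos by simp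
    then have "A.q * card (Q M2) < card W" using Pcard[OF M2(1)] by linarith
    then show "\<exists>M\<in>B. A.q * card (Q M) < card W" using M2(1) by blast
  qed
  finally have "A.q * card W < card B * card W" by simp
  then have "A.q < card B" by simp
  also have "card B \<le> card C" using fin by (intro card_mono) (auto simp: B_def)
  finally show "card (carrier (R Quot K M1)) < card C" .
qed

end

section \<open>The upper bound, by the lines of a plane\<close>

context radical_avoiding_pair
begin

text \<open>Modulo \<open>N = M \<inter> M' \<inter> J\<close> the radical is a plane over the residue field; its \<open>q + 1\<close> lines give the cover.\<close>

lemma covering_number_le_card_residue_field:
  assumes K: "A.K M = A.K M'" and ne: "M \<noteq> M'"
  shows "covering_number R \<le> enat (A.q + 1)"
proof -
  interpret BA: radical_avoiding_pair R M' M
    by (intro radical_avoiding_pair.intro A.radical_avoiding_subring_axioms B.radical_avoiding_subring_axioms)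
  obtain u where u: "u \<in> A.J" "u \<in> M" "u \<notin> M'" by (rule radical_part_not_subset[OF ne])
  obtain w where w: "w \<in> A.J" "w \<in> M'" "w \<notin> M" by (rule BA.radical_part_not_subset[OF ne[symmetric]])
  note uc = A.J_closed(1)[OF u(1)] and wc = A.J_closed(1)[OF w(1)]
  \<comment> \<open>Not intersected with \<open>J\<close>: this is the full
    \<open>M \<inter> M'\<close>, so that \<open>N + J = R\<close>.\<close>
  define N where "N = M \<inter> M'"
  have N: "nonunital_subring N R"
  proof -
    have "nonunital_subring (carrier R \<inter> \<Inter>{M, M'}) R"
      using A.M_subring B.M_subring by (intro A.nonunital_subring_Inter) blast
    also have "carrier R \<inter> \<Inter>{M, M'} = N"
      unfolding N_def using A.M_closed(1) by blast
    finally show ?thesis .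
  qed
  define S where "S v = N <+>\<^bsub>R\<^esub> PIdl v" for v
  have memS: "n \<oplus> s \<otimes> v \<in> S v" if "n \<in> N" "s \<in> carrier R" for n s v
    using that unfolding S_def set_add_def' cgenideal_def by blast
  have S: "nonunital_subring (S v) R" if "v \<in> carrier R" for v
    unfolding S_def by (rule A.nonunital_subring_add_ideal(1)[OF N A.cgenideal_ideal[OF that]])
  \<comment> \<open>\<open>u\<close> and \<open>w\<close> cannot both be multiples of one
    \<open>v\<close> modulo \<open>N\<close>: \<open>u = n \<oplus> s \<otimes> v\<close> outside
    \<open>M'\<close> forces \<open>s\<close> outside the conductor, then \<open>u\<close> in
    \<open>M\<close> forces \<open>v\<close> into \<open>M\<close>, and \<open>w\<close> would
    follow.\<close>
  have proper: "S v \<noteq> carrier R" if v: "v \<in> A.J" for v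
  proof
    assume eq: "S v = carrier R"
    note vc = A.J_closed(1)[OF v]
    have "u \<in> S v" "w \<in> S v" using eq uc wc by simp_all
    then obtain n s n' s' where
      us: "n \<in> N" "s \<in> carrier R" "u = n \<oplus> s \<otimes> v" and
      ws: "n' \<in> N" "s' \<in> carrier R" "w = n' \<oplus> s' \<otimes> v"
      unfolding S_def set_add_def' cgenideal_def by blast
    have n: "n \<in> M" "n \<in> M'" "n' \<in> M" using us(1) ws(1) by (simp_all add: N_def)
    have "s \<notin> A.K M"
    proof
      assume "s \<in> A.K M"
      then have "s \<otimes> v \<in> M'" using B.conductor_mult_radical v K by blast
      then have "u \<in> M'" unfolding us(3) using B.M_closed(3)[OF n(2)] by blast
      with u(3) show False ..
    qed
    moreover have "s \<otimes> v \<in> M"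
      using A.M_add_cancel[OF _ n(1) A.m_closed[OF us(2) vc]] u(2) us(3) by simp
    ultimately have "v \<in> M" using A.conductor_cancel[OF us(2) _ v] by blast
    then have "s' \<otimes> v \<in> M" by (rule A.mult_radical_part_in_M[OF ws(2) v])
    then have "w \<in> M" unfolding ws(3) using A.M_closed(3)[OF n(3)] by blast
    with w(3) show False ..
  qed
  obtain T where T: "T \<subseteq> carrier R" "card T = A.q"
    and Tmod: "\<And>x. x \<in> carrier R \<Longrightarrow> \<exists>t\<in>T. x \<ominus> t \<in> A.K M"
    using A.residue_field_transversal[OF A.conductor_maximalideal] by blast
  have finT: "finite T" using finite_subset[OF T(1) A.finite_carrier] .
  \<comment> \<open>Generators of the lines of the plane with basis \<open>u\<close>,
    \<open>w\<close>: the point at infinity \<open>w\<close> and the affine points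
    \<open>u \<oplus> t \<otimes> w\<close>.\<close>
  define V where "V = insert w ((\<lambda>t. u \<oplus> t \<otimes> w) ` T)"
  have VJ: "v \<in> A.J" if "v \<in> V" for v
  proof -
    have "u \<oplus> t \<otimes> w \<in> A.J" if "t \<in> T" for t
      using A.J_closed(3)[OF u(1) A.J_closed(6)[OF _ w(1)]] that T(1) by blast
    then show ?thesis using \<open>v \<in> V\<close> w(1) unfolding V_def by blast
  qed
  have cov: "\<exists>v\<in>V. x \<in> S v" if x: "x \<in> carrier R" for x
  proof -
    obtain a j where a: "a \<in> M" "j \<in> A.J" "x = a \<oplus> j"
      by (rule A.add_radical_decomposition[OF x])
    obtain b j' where b: "b \<in> M'" "j' \<in> A.J" "x = b \<oplus> j'"
      by (rule B.add_radical_decomposition[OF x])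
    note car = A.M_closed(1)[OF a(1)] A.J_closed(1)[OF a(2)] B.M_closed(1)[OF b(1)] A.J_closed(1)[OF b(2)] uc wc
    obtain n s where n: "n \<in> A.J" "n \<in> M'" "s \<in> carrier R" "j' \<ominus> j = n \<oplus> s \<otimes> u"
      by (rule B.radical_decomposition[OF u(1,3) A.J_closed(4)[OF b(2) a(2)]])
    note nc = A.J_closed(1)[OF n(1)]
    \<comment> \<open>An \<open>M\<close>-part of \<open>x\<close> moved into \<open>M'\<close> as
      well: subtracting a multiple of \<open>u\<close> stays in \<open>M\<close>, and
      \<open>s\<close> is chosen so that \<open>c = b \<oplus> n\<close> with both terms in
      \<open>M'\<close>.\<close>
    define c where "c = a \<ominus> s \<otimes> u"
    have cM: "c \<in> M"
      unfolding c_def using A.M_closed(4)[OF a(1) A.mult_radical_part_in_M[OF n(3) u(1,2)]] .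
    have "c = x \<ominus> j \<ominus> s \<otimes> u" unfolding c_def a(3) using car n(3) by algebra
    also have "\<dots> = b \<oplus> (j' \<ominus> j) \<ominus> s \<otimes> u" unfolding b(3) using car n(3) by algebra
    also have "\<dots> = b \<oplus> n" unfolding n(4) using car n(3) nc by algebra
    finally have "c \<in> M'" using B.M_closed(3)[OF b(1) n(2)] by simp
    with cM have cN: "c \<in> N" by (simp add: N_def)
    define d where "d = j \<oplus> s \<otimes> u"
    have dJ: "d \<in> A.J" unfolding d_def using A.J_closed(3)[OF a(2) A.J_closed(6)[OF n(3) u(1)]] .
    have cd: "x = c \<oplus> d" unfolding c_def d_def a(3) using car n(3) by algebra
    obtain n1 s1 where n1: "n1 \<in> A.J" "n1 \<in> M'" "s1 \<in> carrier R" "d = n1 \<oplus> s1 \<otimes> u"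
      by (rule B.radical_decomposition[OF u(1,3) dJ])
    obtain n2 s2 where n2: "n2 \<in> A.J" "n2 \<in> M" "s2 \<in> carrier R" "n1 = n2 \<oplus> s2 \<otimes> w"
      by (rule A.radical_decomposition[OF w(1,3) n1(1)])
    have n2c: "n2 \<in> carrier R" using A.J_closed(1)[OF n2(1)] .
    have "n2 = n1 \<ominus> s2 \<otimes> w" unfolding n2(4) using n2c n2(3) wc by algebra
    then have "n2 \<in> M'"
      using B.M_closed(4)[OF n1(2) B.mult_radical_part_in_M[OF n2(3) w(1,2)]] by simp
    with n2(2) have n2N: "n2 \<in> N" by (simp add: N_def)
    define g where "g = c \<oplus> n2"
    have gN: "g \<in> N" unfolding g_def by (rule A.nonunital_subringD(4)[OF N cN n2N])
    have gc: "g \<in> carrier R" using gN A.nonunital_subringD(2)[OF N] by blast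
    have cc: "c \<in> carrier R" using A.M_closed(1)[OF cM] .
    have x_eq: "x = g \<oplus> (s1 \<otimes> u \<oplus> s2 \<otimes> w)"
      unfolding cd n1(4) n2(4) g_def using cc n2c n1(3) n2(3) uc wc by algebra
    have KN: "k \<otimes> i \<in> N" if "k \<in> A.K M" "i \<in> A.J" for k i
      unfolding N_def using A.conductor_mult_radical[OF that] B.conductor_mult_radical[OF _ that(2)] that(1) K
      by blast
    show ?thesis
    proof (cases "s1 \<in> A.K M")
      case True
      have "(g \<oplus> s1 \<otimes> u) \<oplus> s2 \<otimes> w \<in> S w"
        by (rule memS[OF A.nonunital_subringD(4)[OF N gN KN[OF True u(1)]] n2(3)])
      also have "(g \<oplus> s1 \<otimes> u) \<oplus> s2 \<otimes> w = x"
        unfolding x_eq using gc n1(3) n2(3) uc wc by algebra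
      finally show ?thesis unfolding V_def by blast
    next
      case False
      obtain z where z: "z \<in> carrier R" "\<one> \<ominus> z \<otimes> s1 \<in> A.K M"
        by (rule A.conductor_inverse[OF n1(3) False])
      obtain t where t: "t \<in> T" "z \<otimes> s2 \<ominus> t \<in> A.K M"
        using Tmod[OF A.m_closed[OF z(1) n2(3)]] by blast
      have tc: "t \<in> carrier R" using t(1) T(1) by blast
      interpret KI: ideal "A.K M" R by (rule A.conductor_ideal)
      \<comment> \<open>With \<open>z\<close> inverse to \<open>s1\<close> and \<open>t\<close>
        congruent to \<open>z \<otimes> s2\<close>, this shows \<open>s2\<close> congruent to
        \<open>s1 \<otimes> t\<close> modulo the conductor. Hence \<open>s1 u + s2 w\<close> is
        \<open>s1 (u + t w)\<close> up to an element of \<open>N\<close>.\<close>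
      have "s2 \<otimes> (\<one> \<ominus> z \<otimes> s1) \<oplus> s1 \<otimes> (z \<otimes> s2 \<ominus> t) \<in> A.K M"
        using KI.I_l_closed[OF z(2) n2(3)] KI.I_l_closed[OF t(2) n1(3)] by blast
      also have "s2 \<otimes> (\<one> \<ominus> z \<otimes> s1) \<oplus> s1 \<otimes> (z \<otimes> s2 \<ominus> t) = s2 \<ominus> s1 \<otimes> t"
        using z(1) n1(3) n2(3) tc by algebra
      finally have "(s2 \<ominus> s1 \<otimes> t) \<otimes> w \<in> N" using KN w(1) by blast
      then have "(g \<oplus> (s2 \<ominus> s1 \<otimes> t) \<otimes> w) \<oplus> s1 \<otimes> (u \<oplus> t \<otimes> w) \<in> S (u \<oplus> t \<otimes> w)"
        using memS[OF A.nonunital_subringD(4)[OF N gN] n1(3)] by blast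
      also have "(g \<oplus> (s2 \<ominus> s1 \<otimes> t) \<otimes> w) \<oplus> s1 \<otimes> (u \<oplus> t \<otimes> w) = x"
        unfolding x_eq using gc n1(3) n2(3) tc uc wc by algebra
      finally show ?thesis unfolding V_def using t(1) by blast
    qed
  qed
  have SV: "nonunital_subring (S v) R" "S v \<noteq> carrier R" if "v \<in> V" for v
    using S[OF A.J_closed(1)[OF VJ[OF that]]] proper[OF VJ[OF that]] by blast+
  have "ring_cover R (S ` V)"
    unfolding ring_cover_def
  proof (intro conjI ballI)
    fix Y assume "Y \<in> S ` V"
    then show "nonunital_subring Y R" "Y \<noteq> carrier R" using SV by blast+
  next
    have "Y \<subseteq> carrier R" if "Y \<in> S ` V" for Y
      using that SV(1) A.nonunital_subringD(2) by blast
    then show "\<Union>(S ` V) = carrier R" using cov by blast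
  qed
  moreover have "finite V" using finT by (simp add: V_def)
  ultimately have "covering_number R \<le> enat (card (S ` V))"
    using covering_number_le_card finite_imageI by blast
  also have "card (S ` V) \<le> card V" by (rule card_image_le[OF \<open>finite V\<close>])
  also have "card V \<le> A.q + 1"
  proof -
    have "card V \<le> Suc (card ((\<lambda>t. u \<oplus> t \<otimes> w) ` T))"
      unfolding V_def by (rule card_insert_le_m1) simp_all
    also have "\<dots> \<le> Suc (card T)" using card_image_le[OF finT] by simp
    finally show ?thesis using T(2) by simp
  qed
  finally show ?thesis by simp
qed

end

text \<open>The first alternative speaks of a cover instead of \<open>R / J\<close>, so that it can
  be pulled back along a surjection which need not map radical onto radical.\<close>

theorem (in finite_cring) minimal_cover_contains_radical_or_prime_power:
  assumes fin: "covering_number R \<noteq> \<infinity>"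
  shows "(\<exists>C. ring_cover R C \<and> finite C \<and> covering_number R = enat (card C) \<and> (\<forall>Y\<in>C. J \<subseteq> Y)) \<or>
    (\<exists>p d :: nat. Factorial_Ring.prime p \<and> 0 < d \<and> covering_number R = enat (p ^ d + 1))"
proof -
  obtain C0 where C0: "ring_cover R C0" "finite C0" "covering_number R = enat (card C0)"
    by (rule covering_number_attained[OF fin])
  have "\<exists>M. maximal_nonunital_subring M R \<and> Y \<subseteq> M" if "Y \<in> C0" for Y
  proof -
    have "nonunital_subring Y R" "Y \<noteq> carrier R"
      using that C0(1) unfolding ring_cover_def by blast+
    then show ?thesis by (rule exists_maximal_nonunital_subring) blast
  qed
  then obtain f where f: "\<And>Y. Y \<in> C0 \<Longrightarrow> maximal_nonunital_subring (f Y) R \<and> Y \<subseteq> f Y"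
    by metis
  \<comment> \<open>Enlarging the members to maximal subrings cannot increase their number, and
    minimality forbids a decrease.\<close>
  define C where "C = f ` C0"
  have max: "maximal_nonunital_subring M R" if "M \<in> C" for M
    using that f unfolding C_def by blast
  then have sub: "nonunital_subring M R" "M \<noteq> carrier R" if "M \<in> C" for M
    using that unfolding maximal_nonunital_subring_def by blast+
  have "carrier R \<subseteq> \<Union>C"
    using C0(1) f unfolding C_def ring_cover_def by blast
  moreover have "\<Union>C \<subseteq> carrier R" using sub(1) nonunital_subringD(2) by blast
  ultimately have cov: "\<Union>C = carrier R" by blast
  with sub have C: "ring_cover R C" unfolding ring_cover_def by blast
  have finC: "finite C" using C0(2) by (simp add: C_def)
  have "card C \<le> card C0" unfolding C_def by (rule card_image_le[OF C0(2)])
  with covering_number_le_card[OF C finC] have cn: "covering_number R = enat (card C)"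
    using C0(3) by simp
  show ?thesis
  proof (cases "\<forall>M\<in>C. J \<subseteq> M")
    case True
    with C finC cn show ?thesis by blast
  next
    case False
    then obtain M1 where M1: "M1 \<in> C" "\<not> J \<subseteq> M1" by blast
    have irr: "\<Union>(C - {M1}) \<noteq> carrier R"
    proof
      assume "\<Union>(C - {M1}) = carrier R"
      then have "ring_cover R (C - {M1})" using sub unfolding ring_cover_def by blast
      then have "covering_number R \<le> enat (card (C - {M1}))"
        using finC by (intro covering_number_le_card) simp_all
      then show False using cn card_Diff1_less[OF finC M1(1)] by simp
    qed
    note large = radical_avoiding_cover_large[OF cov finC max M1 irr]
    obtain M2 where M2: "M2 \<in> C" "M2 \<noteq> M1" "\<not> J \<subseteq> M2" "K M2 = K M1"
      using large(1) by blast
    interpret P: radical_avoiding_pair R M1 M2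
      by (intro radical_avoiding_pair.intro radical_avoiding_subringI max M1 M2)
    have "card C \<le> P.A.q + 1"
      using P.covering_number_le_card_residue_field[OF M2(4)[symmetric] M2(2)[symmetric]] cn by simp
    with large(2) have "card C = P.A.q + 1" by simp
    then show ?thesis
      using residue_field_card_prime_power[OF P.A.conductor_maximalideal] cn by auto
  qed
qed

theorem corollary4p9:
  fixes R :: "('a, 'm) ring_scheme"
  assumes "cring R"
    and "covering_number R \<noteq> \<infinity>"
  shows "covering_number R = covering_number (R Quot jacobson_radical R) \<or>
    (\<exists>p d :: nat. Factorial_Ring.prime p \<and> 0 < d \<and> covering_number R = enat (p ^ d + 1))"
proof -
  interpret R: cring R by fact
  obtain C where C: "ring_cover R C" "finite C" "covering_number R = enat (card C)"
    by (rule covering_number_attained[OF assms(2)])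
  have sub: "nonunital_subring Y R" if "Y \<in> C" for Y
    using that C(1) unfolding ring_cover_def by blast
  have cov: "\<Union>C = carrier R" using C(1) unfolding ring_cover_def by blast
  have irr: "\<Union>S \<noteq> carrier R" if S: "S \<subset> C" for S
  proof
    assume "\<Union>S = carrier R"
    then have "ring_cover R S" using C(1) S unfolding ring_cover_def by blast
    then have "covering_number R \<le> enat (card S)"
      using finite_subset[OF psubset_imp_subset[OF S] C(2)] by (rule covering_number_le_card)
    then show False using C(3) psubset_card_mono[OF C(2) S] by simp
  qed
  obtain T where T: "finite T" "T \<subseteq> carrier R"
    "\<And>x. x \<in> carrier R \<Longrightarrow> \<exists>t\<in>T. x \<ominus>\<^bsub>R\<^esub> t \<in> carrier R \<inter> \<Inter>C"
    using R.irredundant_cover_finite_index[OF C(2) R.nonunital_subringD(1)[OF sub] cov irr] by blast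
  \<comment> \<open>\<open>I\<close> lies in every member of the minimal cover, so the cover
    descends to \<open>R Quot I\<close> and the covering number does not change.\<close>
  obtain I where I: "ideal I R" "I \<subseteq> carrier R \<inter> \<Inter>C" "finite (carrier (R Quot I))"
    by (rule R.finite_index_subring_contains_ideal[OF R.nonunital_subring_Inter[OF sub] T])
  define S where "S = R Quot I"
  have "cring S" unfolding S_def by (rule ideal.quotient_is_cring[OF I(1) assms(1)])
  then interpret S: finite_cring S
    using I(3) by (simp add: finite_cring_def finite_cring_axioms_def S_def)
  define h where "h = (+>\<^bsub>R\<^esub>) I"
  have hom: "ring_hom_cring R S h"
    unfolding S_def h_def by (rule ideal.rcos_ring_hom_cring[OF I(1) assms(1)])
  then interpret h: ring_hom_cring R S h .
  have surj: "h ` carrier R = carrier S"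
    unfolding S_def h_def by (auto simp: FactRing_simps)
  have "covering_number S \<le> covering_number R"
    unfolding S_def C(3) using I(2) by (intro ideal.covering_number_Quot_le[OF I(1) C(1,2)]) blast
  moreover have "covering_number R \<le> covering_number S"
    by (rule h.ring.covering_number_le_image[OF surj])
  ultimately have eq: "covering_number R = covering_number S" by (rule antisym[rotated])
  have fin: "covering_number S \<noteq> \<infinity>" using assms(2) by (simp add: eq)
  note J = R.jacobson_radical_ideal
  show ?thesis
    using S.minimal_cover_contains_radical_or_prime_power[OF fin]
  proof
    assume "\<exists>C. ring_cover S C \<and> finite C \<and> covering_number S = enat (card C) \<and> (\<forall>Y\<in>C. jacobson_radical S \<subseteq> Y)"
    then obtain D where D: "ring_cover S D" "finite D" "covering_number S = enat (card D)"
      "\<And>Y. Y \<in> D \<Longrightarrow> jacobson_radical S \<subseteq> Y" by blast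
    define D' where "D' = (\<lambda>Y. {x \<in> carrier R. h x \<in> Y}) ` D"
    have "ring_cover R D'"
      unfolding D'_def by (rule h.ring.ring_cover_vimage[OF surj D(1)])
    moreover have "finite D'" using D(2) by (simp add: D'_def)
    moreover have "jacobson_radical R \<subseteq> Y" if Y: "Y \<in> D'" for Y
    proof
      fix x assume x: "x \<in> jacobson_radical R"
      have "x \<in> carrier R" using x by (simp add: jacobson_radical_def)
      moreover have "h x \<in> jacobson_radical S" by (rule h.jacobson_radical_image[OF surj x])
      ultimately show "x \<in> Y" using Y D(4) unfolding D'_def by blast
    qed
    ultimately have "covering_number (R Quot jacobson_radical R) \<le> enat (card D')"
      by (rule ideal.covering_number_Quot_le[OF J])
    also have "\<dots> \<le> covering_number R"
      unfolding eq D(3) D'_def using card_image_le[OF D(2)] by simp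
    finally have "covering_number (R Quot jacobson_radical R) \<le> covering_number R" .
    moreover have "covering_number R \<le> covering_number (R Quot jacobson_radical R)"
      by (rule ring_hom_ring.covering_number_le_image[OF ideal.rcos_ring_hom_ring[OF J]])
        (auto simp: FactRing_simps)
    ultimately show ?thesis by simp
  next
    assume "\<exists>p d :: nat. Factorial_Ring.prime p \<and> 0 < d \<and> covering_number S = enat (p ^ d + 1)"
    then show ?thesis unfolding eq by blast
  qed
qed

end
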